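(* Let $A=\mathbb{F}_q[T]$, let $\mathfrak p\subset A$ be a nonzero prime ideal, let $f\in A[x]$ be monic and irreducible, and let $R=A[x]/f(x)$. Then the map $$\phi:\{\mathfrak p\text{-overorders of }R\}\to\{A_{(\mathfrak p)}\text{-overorders of }R_{(\mathfrak p)}\},\qquad S\mapsto S_{(\mathfrak p)},$$ is a bijection.
   Context: $K$ is the fraction field of $R$. $A_{(\mathfrak p)}$ is the localisation of $A$ at $\mathfrak p$. For an $A$-order $S$ in $K$ with $A$-basis $1,a_1,\dots,a_{r-1}$, $S_{(\mathfrak p)}=A_{(\mathfrak p)}+a_1A_{(\mathfrak p)}+\dots+a_{r-1}A_{(\mathfrak p)}$. For a finitely generated torsion $A$-module $M\cong A/\mathfrak a_1\oplus\dots\oplus A/\mathfrak a_n$, the order ideal is $\mathrm{ord}(M)=\prod_i\mathfrak a_i$; for $A$-modules $N'\subset N$ with $N/N'$ finitely generated torsion, the index ideal is $[N:N']=\mathrm{ord}(N/N')$. A $\mathfrak p$-overorder of $R$ is an $A$-order $S$ in $K$ with $R\subseteq S$ such that the index ideal $[S:R]$ is a power of $\mathfrak p$ (including $\mathfrak p^0=A$). An $A_{(\mathfrak p)}$-overorder of $R_{(\mathfrak p)}$ is an $A_{(\mathfrak p)}$-order in $K$ containing $R_{(\mathfrak p)}$. *)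

theory Defs
  imports
    "HOL-Algebra.Algebraic_Closure_Type"
    "HOL-Algebra.Ideal_Product"
    "HOL-Algebra.Module"
    "HOL-Algebra.QuotRing"
    "HOL-Algebra.Subrings"
    "HOL-Computational_Algebra.Polynomial"
begin

section \<open>Order ideals and index ideals\<close>

text \<open>The \<open>mult\<close> and \<open>one\<close> fields that a module record inherits from \<open>ring\<close> play no role
  for modules; they are left undefined where there is no ring structure to put there.\<close>

definition regular_module :: "('r, 'm) ring_scheme \<Rightarrow> ('r, 'r) module" where
  "regular_module R =
    \<lparr>carrier = carrier R, monoid.mult = (\<otimes>\<^bsub>R\<^esub>), one = \<one>\<^bsub>R\<^esub>, zero = \<zero>\<^bsub>R\<^esub>, add = (\<oplus>\<^bsub>R\<^esub>),
     module.smult = (\<otimes>\<^bsub>R\<^esub>)\<rparr>"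

definition quotient_module :: "('r, 'x, 'm) module_scheme \<Rightarrow> 'x set \<Rightarrow> ('r, 'x set) module" where
  "quotient_module M N =
    \<lparr>carrier = a_rcosets\<^bsub>M\<^esub> N, monoid.mult = undefined, one = undefined, zero = N, add = set_add M,
     module.smult = (\<lambda>r C. \<Union>x\<in>C. N +>\<^bsub>M\<^esub> (r \<odot>\<^bsub>M\<^esub> x))\<rparr>"

definition direct_sum_module ::
    "'i set \<Rightarrow> ('i \<Rightarrow> ('r, 'x, 'm) module_scheme) \<Rightarrow> ('r, 'i \<Rightarrow> 'x) module" where
  "direct_sum_module I M =
    \<lparr>carrier = (\<Pi>\<^sub>E i\<in>I. carrier (M i)), monoid.mult = undefined, one = undefined,
     zero = (\<lambda>i\<in>I. \<zero>\<^bsub>M i\<^esub>), add = (\<lambda>x y. \<lambda>i\<in>I. x i \<oplus>\<^bsub>M i\<^esub> y i),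
     module.smult = (\<lambda>r x. \<lambda>i\<in>I. r \<odot>\<^bsub>M i\<^esub> x i)\<rparr>"

definition module_isomorphic ::
    "('r, 'l) ring_scheme \<Rightarrow> ('r, 'x, 'm) module_scheme \<Rightarrow> ('r, 'y, 'n) module_scheme \<Rightarrow> bool" where
  "module_isomorphic R M N \<longleftrightarrow>
    (\<exists>h \<in> iso (add_monoid M) (add_monoid N).
       \<forall>r \<in> carrier R. \<forall>x \<in> carrier M. h (r \<odot>\<^bsub>M\<^esub> x) = r \<odot>\<^bsub>N\<^esub> h x)"

text \<open>\<open>has_order_ideal R M I\<close> reads: \<open>M\<close> is finitely generated torsion and \<open>ord(M) = I\<close>.
  The ideals \<open>a i\<close> are nonzero because \<open>M\<close> is torsion; \<open>n = 0\<close> and \<open>a i = carrier R\<close> are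
  allowed. \<open>ideals_set R\<close> carries the product of ideals.\<close>

definition has_order_ideal ::
    "('r, 'l) ring_scheme \<Rightarrow> ('r, 'x, 'm) module_scheme \<Rightarrow> 'r set \<Rightarrow> bool" where
  "has_order_ideal R M I \<longleftrightarrow>
    (\<exists>(n::nat) a. (\<forall>i<n. ideal (a i) R \<and> a i \<noteq> {\<zero>\<^bsub>R\<^esub>}) \<and>
       module_isomorphic R M
         (direct_sum_module {..<n} (\<lambda>i. quotient_module (regular_module R) (a i))) \<and>
       I = finprod (ideals_set R) a {..<n})"

definition has_index_ideal ::
    "('r, 'l) ring_scheme \<Rightarrow> ('r, 'x, 'm) module_scheme \<Rightarrow> 'x set \<Rightarrow> 'r set \<Rightarrow> bool" where
  "has_index_ideal R N N' I \<longleftrightarrow> has_order_ideal R (quotient_module N N') I"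


section \<open>Orders in a field\<close>

text \<open>In this section \<open>D\<close> is a subring of the field \<^typ>\<open>'k\<close>.\<close>

definition span_over :: "'k set \<Rightarrow> 'k set \<Rightarrow> 'k::field set" where
  "span_over D B = {\<Sum>b\<in>F. c b * b | F c. finite F \<and> F \<subseteq> B \<and> (\<forall>b\<in>F. c b \<in> D)}"

definition is_basis_over :: "'k set \<Rightarrow> 'k set \<Rightarrow> 'k::field set \<Rightarrow> bool" where
  "is_basis_over D S B \<longleftrightarrow> finite B \<and> span_over D B = S \<and>
    (\<forall>c. (\<forall>b\<in>B. c b \<in> D) \<and> (\<Sum>b\<in>B. c b * b) = 0 \<longrightarrow> (\<forall>b\<in>B. c b = 0))"

definition fractions :: "'k set \<Rightarrow> 'k::field set" where
  "fractions D = {a / b | a b. a \<in> D \<and> b \<in> D \<and> b \<noteq> 0}"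

text \<open>A \<open>D\<close>-order in the field \<^typ>\<open>'k\<close>: a subring containing \<open>D\<close> that is finitely generated as
  a \<open>D\<close>-module and spans the field over the fraction field of \<open>D\<close>.\<close>

definition is_order_over :: "'k set \<Rightarrow> 'k::field set \<Rightarrow> bool" where
  "is_order_over D S \<longleftrightarrow>
    subring S (ring_of_type_algebra :: 'k ring) \<and> D \<subseteq> S \<and>
    (\<exists>B. finite B \<and> span_over D B = S) \<and>
    span_over (fractions D) S = UNIV"


section \<open>Localisation at a prime\<close>

text \<open>Here \<open>j\<close> is an injective homomorphism from \<open>A\<close> to the field, so that \<open>range j\<close> is the copy
  of \<open>A\<close> inside the field.\<close>

definition localised_ring :: "('a \<Rightarrow> 'k) \<Rightarrow> 'a set \<Rightarrow> 'k::field set" where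
  "localised_ring j \<pp> = {j a / j s | a s. s \<notin> \<pp>}"

text \<open>\<open>A\<^sub>\<pp> + a\<^sub>1 A\<^sub>\<pp> + \<dots>\<close> for an \<open>A\<close>-basis \<open>1, a\<^sub>1, \<dots>\<close> of \<open>S\<close>; by \<open>localised_order_eq\<close>
  below, every choice of basis gives the same result.\<close>

definition localised_order :: "('a \<Rightarrow> 'k) \<Rightarrow> 'a set \<Rightarrow> 'k set \<Rightarrow> 'k::field set" where
  "localised_order j \<pp> S =
    span_over (localised_ring j \<pp>) (SOME B. 1 \<in> B \<and> is_basis_over (range j) S B)"

definition overorders_at :: 
    "('a::comm_ring_1 \<Rightarrow> 'k) \<Rightarrow> 'a set \<Rightarrow> 'k set \<Rightarrow> 'k::field set set" where
  "overorders_at j \<pp> R =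
    {S. is_order_over (range j) S \<and> R \<subseteq> S \<and>
        (\<exists>n::nat. has_index_ideal ring_of_type_algebra
           \<lparr>carrier = S, monoid.mult = (*), one = 1, zero = 0, add = (+), module.smult = (\<lambda>a x. j a * x)\<rparr> R
           (\<pp> [^]\<^bsub>ideals_set ring_of_type_algebra\<^esub> n))}"

definition overorders_over :: "'k set \<Rightarrow> 'k set \<Rightarrow> 'k::field set set" where
  "overorders_over D R = {S. is_order_over D S \<and> R \<subseteq> S}"


section \<open>The ring \<open>A[x]/(f)\<close> and its fraction field\<close>

definition poly_quotient :: "'a::comm_ring_1 poly \<Rightarrow> 'a poly set ring" where
  "poly_quotient f = ring_of_type_algebra Quot (cgenideal ring_of_type_algebra f)"

text \<open>\<open>\<iota>\<close> exhibits the type \<^typ>\<open>'k\<close> as the fraction field of \<open>R\<close>.\<close>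

definition is_fraction_field :: "('r, 'm) ring_scheme \<Rightarrow> ('r \<Rightarrow> 'k::field) \<Rightarrow> bool" where
  "is_fraction_field R \<iota> \<longleftrightarrow>
    \<iota> \<in> ring_hom R (ring_of_type_algebra :: 'k ring) \<and> inj_on \<iota> (carrier R) \<and>
    (\<forall>z. \<exists>a\<in>carrier R. \<exists>b\<in>carrier R. b \<noteq> \<zero>\<^bsub>R\<^esub> \<and> z = \<iota> a / \<iota> b)"

definition base_map :: "'a::comm_ring_1 poly \<Rightarrow> ('a poly set \<Rightarrow> 'k) \<Rightarrow> 'a \<Rightarrow> 'k" where
  "base_map f \<iota> a =
    \<iota> (cgenideal ring_of_type_algebra f +>\<^bsub>ring_of_type_algebra\<^esub> [:a:])"


section \<open>Independence of the basis\<close>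

lemma span_over_superset:
  assumes "1 \<in> D" shows "B \<subseteq> span_over D B"
proof
  fix b assume "b \<in> B"
  then have "(\<Sum>b\<in>{b}. 1 * b) \<in> span_over D B"
    unfolding span_over_def using assms by (intro CollectI exI[of _ "{b}"] exI[of _ "\<lambda>_. 1"]) simp
  then show "b \<in> span_over D B" by simp
qed

lemma span_over_eqI:
  assumes E: "E \<subseteq> D" "1 \<in> E" and D: "0 \<in> D" "\<And>x y. x \<in> D \<Longrightarrow> y \<in> D \<Longrightarrow> x + y \<in> D"
    "\<And>x y. x \<in> D \<Longrightarrow> y \<in> D \<Longrightarrow> x * y \<in> D"
    and B: "finite B" "span_over E B = S"
  shows "span_over D B = span_over D S"
proof
  have "B \<subseteq> S" using span_over_superset[OF E(2), of B] B by simp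
  then show "span_over D B \<subseteq> span_over D S" unfolding span_over_def by blast
next
  have full: "\<exists>c. (\<forall>b\<in>B. c b \<in> D) \<and> x = (\<Sum>b\<in>B. c b * b)" if "x \<in> S" for x
  proof -
    from that B obtain F c where F: "finite F" "F \<subseteq> B" "\<forall>b\<in>F. c b \<in> E"
      and x: "x = (\<Sum>b\<in>F. c b * b)" unfolding span_over_def by blast
    define d where "d b = (if b \<in> F then c b else 0)" for b
    have "x = (\<Sum>b\<in>B. d b * b)"
      unfolding x d_def using F B(1) by (intro sum.mono_neutral_cong_left) auto
    moreover have "\<forall>b\<in>B. d b \<in> D" using F E D by (auto simp: d_def)
    ultimately show ?thesis by blast
  qed
  have sumD: "(\<Sum>i\<in>I. g i) \<in> D" if "finite I" "\<forall>i\<in>I. g i \<in> D" for I and g :: "'a \<Rightarrow> 'a"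
    using that by (induction I rule: finite_induct) (auto intro: D)
  show "span_over D S \<subseteq> span_over D B"
  proof
    fix x assume "x \<in> span_over D S"
    then obtain F c where F: "finite F" "F \<subseteq> S" "\<forall>s\<in>F. c s \<in> D"
      and x: "x = (\<Sum>s\<in>F. c s * s)" unfolding span_over_def by blast
    from full F(2) have "\<forall>s\<in>F. \<exists>d. (\<forall>b\<in>B. d b \<in> D) \<and> s = (\<Sum>b\<in>B. d b * b)" by blast
    then obtain d where d: "\<forall>s\<in>F. (\<forall>b\<in>B. d s b \<in> D) \<and> s = (\<Sum>b\<in>B. d s b * b)"
      by metis
    have "x = (\<Sum>s\<in>F. c s * (\<Sum>b\<in>B. d s b * b))"
      unfolding x using d by (intro sum.cong) auto
    also have "\<dots> = (\<Sum>s\<in>F. \<Sum>b\<in>B. c s * d s b * b)"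
      by (simp add: sum_distrib_left mult.assoc)
    also have "\<dots> = (\<Sum>b\<in>B. \<Sum>s\<in>F. c s * d s b * b)" by (rule sum.swap)
    also have "\<dots> = (\<Sum>b\<in>B. (\<Sum>s\<in>F. c s * d s b) * b)"
      by (simp add: sum_distrib_right)
    finally have *: "x = (\<Sum>b\<in>B. (\<Sum>s\<in>F. c s * d s b) * b)" .
    have "\<forall>b\<in>B. (\<Sum>s\<in>F. c s * d s b) \<in> D"
      using F d by (auto intro!: sumD D(3))
    with * B(1) show "x \<in> span_over D B" unfolding span_over_def
      by (intro CollectI exI[of _ B] exI[of _ "\<lambda>b. \<Sum>s\<in>F. c s * d s b"]) auto
  qed
qed

lemma localised_order_eq:
  fixes j :: "'a::comm_ring_1 \<Rightarrow> 'k::field"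
  assumes j: "j \<in> ring_hom ring_of_type_algebra ring_of_type_algebra" "inj j"
    and \<pp>: "primeideal \<pp> ring_of_type_algebra"
    and B: "1 \<in> B" "is_basis_over (range j) S B"
  shows "localised_order j \<pp> S = span_over (localised_ring j \<pp>) B"
proof -
  let ?D = "localised_ring j \<pp>"
  have j1: "j 1 = 1" and ja: "j (x + y) = j x + j y" and jm: "j (x * y) = j x * j y" for x y
    using ring_hom_one[OF j(1)] ring_hom_add[OF j(1), of x y] ring_hom_mult[OF j(1), of x y]
    by (auto simp: ring_of_type_algebra_def)
  have j0: "j 0 = 0" using ja[of 0 0] by (metis add.right_neutral add_left_cancel)
  interpret primeideal \<pp> "ring_of_type_algebra :: 'a ring" by (rule \<pp>)
  have p0: "0 \<in> \<pp>" using additive_subgroup.zero_closed[OF is_additive_subgroup]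
    by (simp add: ring_of_type_algebra_def)
  have p1: "1 \<notin> \<pp>"
    using one_imp_carrier I_notcarr by (auto simp: ring_of_type_algebra_def)
  have pm: "s * t \<notin> \<pp>" if "s \<notin> \<pp>" "t \<notin> \<pp>" for s t
    using I_prime[of s t] that by (auto simp: ring_of_type_algebra_def)
  have nz: "j s \<noteq> 0" if "s \<notin> \<pp>" for s
    using that p0 j0 j(2) by (metis injD)
  have sub: "range j \<subseteq> ?D"
  proof
    fix x assume "x \<in> range j"
    then obtain a where "x = j a" by blast
    then have "x = j a / j 1" by (simp add: j1)
    with p1 show "x \<in> ?D" unfolding localised_ring_def by blast
  qed
  have one: "1 \<in> range j" using j1 by (metis rangeI)
  have zero: "0 \<in> ?D" using sub j0 by (metis rangeI subsetD)
  have add: "x + y \<in> ?D" and mul: "x * y \<in> ?D" if xy: "x \<in> ?D" "y \<in> ?D" for x y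
  proof -
    from xy obtain a s b t where *: "x = j a / j s" "s \<notin> \<pp>" "y = j b / j t" "t \<notin> \<pp>"
      unfolding localised_ring_def by blast
    have "x + y = j (a * t + b * s) / j (s * t)" "x * y = j (a * b) / j (s * t)"
      using * nz[of s] nz[of t] by (simp_all add: ja jm add_frac_eq)
    with pm[OF *(2,4)] show "x + y \<in> ?D" "x * y \<in> ?D" unfolding localised_ring_def by blast+
  qed
  have indep: "span_over ?D C = span_over ?D S" if "is_basis_over (range j) S C" for C
    using that unfolding is_basis_over_def
    by (intro span_over_eqI[OF sub one zero]) (auto intro: add mul)
  define C where "C = (SOME B. 1 \<in> B \<and> is_basis_over (range j) S B)"
  have "is_basis_over (range j) S C"
    unfolding C_def using someI[of "\<lambda>B. 1 \<in> B \<and> is_basis_over (range j) S B" B] B by blast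
  then show ?thesis
    unfolding localised_order_def C_def[symmetric] using indep[OF B(2)] indep by simp
qed

end

theory Submission
  imports Defs
begin

text \<open>Let \<open>\<pi>\<close> generate \<open>\<pp>\<close>. If the index ideal \<open>[S:R]\<close> is a power of \<open>\<pp>\<close>, then
  \<open>\<pi>\<^sup>n S \<subseteq> R\<close> for some \<open>n\<close>. Since \<open>\<pi>\<^sup>n\<close> is coprime to every \<open>s \<notin> \<pp>\<close>, an \<open>x \<in> S\<close> with \<open>s x \<in> S'\<close> lies
  in \<open>S'\<close>, so \<open>S\<close> is determined by its localisation. Conversely, an overorder \<open>T\<close> of the localisation
  is the localisation of \<open>S = {x \<in> T. \<exists>n. \<pi>\<^sup>n x \<in> R}\<close>: clearing denominators on generators of \<open>T\<close>
  gives one \<open>m\<close> with \<open>\<pi>\<^sup>m S \<subseteq> R\<close>, so \<open>S\<close> is finitely generated and, by the theorem on stacked bases,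
  \<open>[S:R]\<close> is a power of \<open>\<pp>\<close>.\<close>

section \<open>Modules over a Euclidean subring of a field\<close>

text \<open>The definition of \<open>localised_order\<close> selects a basis containing 1 by
  \<open>SOME\<close>, so it says nothing about an order until such a basis is known to exist. This
  is why structure theory of orders has to precede the bijection. Afterwards the localisation is the
  set of fractions y / s with y in S and s outside \<pp>, and the later arguments rest on that
  description. Everything takes place inside the field K: A is replaced by its copy
  \<open>range j\<close>, and modules are subsets of K. The generalities are stated for an arbitrary
  subring D because they are applied both to \<open>range j\<close> and to the localised ring.
  Stacked bases are the common tool: they make submodules free and finitely generated, lead to the
  basis vector 1, and diagonalise R inside S, which exhibits the decomposition behind the index
  ideal. For R = A[x]/(f) the delicate point is that K is spanned over the fractions of A: K is
  given as the fraction field of R, so denominators from R have to be traded for denominators from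
  A.\<close>

locale subdomain =
  fixes D :: "'k::field set"
  assumes zero_in: "0 \<in> D" and one_in: "1 \<in> D"
    and add_in: "x \<in> D \<Longrightarrow> y \<in> D \<Longrightarrow> x + y \<in> D"
    and mult_in: "x \<in> D \<Longrightarrow> y \<in> D \<Longrightarrow> x * y \<in> D"
    and uminus_in: "x \<in> D \<Longrightarrow> - x \<in> D"
begin

lemma diff_in: "x \<in> D \<Longrightarrow> y \<in> D \<Longrightarrow> x - y \<in> D"
  using add_in[of x "- y"] uminus_in[of y] by simp

definition submod :: "'k set \<Rightarrow> bool" where
  "submod M \<longleftrightarrow> 0 \<in> M \<and> (\<forall>x\<in>M. \<forall>y\<in>M. x + y \<in> M) \<and> (\<forall>a\<in>D. \<forall>x\<in>M. a * x \<in> M)"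

lemma submod_zero: "submod M \<Longrightarrow> 0 \<in> M"
  and submod_add: "submod M \<Longrightarrow> x \<in> M \<Longrightarrow> y \<in> M \<Longrightarrow> x + y \<in> M"
  and submod_scale: "submod M \<Longrightarrow> a \<in> D \<Longrightarrow> x \<in> M \<Longrightarrow> a * x \<in> M"
  by (auto simp: submod_def)

lemma submod_uminus: "submod M \<Longrightarrow> x \<in> M \<Longrightarrow> - x \<in> M"
  using submod_scale[of M "-1" x] uminus_in[OF one_in] by simp

lemma submod_diff: "submod M \<Longrightarrow> x \<in> M \<Longrightarrow> y \<in> M \<Longrightarrow> x - y \<in> M"
  using submod_add[of M x "- y"] submod_uminus[of M y] by simp

lemma submod_sum: "submod M \<Longrightarrow> (\<And>i. i \<in> I \<Longrightarrow> g i \<in> M) \<Longrightarrow> (\<Sum>i\<in>I. g i) \<in> M"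
  by (induction I rule: infinite_finite_induct) (auto intro: submod_zero submod_add)

lemma submod_self: "submod D"
  by (auto simp: submod_def zero_in add_in mult_in)

lemma submod_Int: "submod M \<Longrightarrow> submod N \<Longrightarrow> submod (M \<inter> N)"
  by (auto simp: submod_def)

lemma submod_image_mult: "submod M \<Longrightarrow> submod ((*) u ` M)"
  unfolding submod_def
proof (intro conjI ballI; elim conjE)
  show "0 \<in> (*) u ` M" if "0 \<in> M" using that by (intro image_eqI[of _ _ 0]) auto
next
  fix x y assume *: "\<forall>x\<in>M. \<forall>y\<in>M. x + y \<in> M" "x \<in> (*) u ` M" "y \<in> (*) u ` M"
  then obtain m n where "m \<in> M" "n \<in> M" "x = u * m" "y = u * n" by auto
  with * show "x + y \<in> (*) u ` M" by (intro image_eqI[of _ _ "m + n"]) (auto simp: algebra_simps)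
next
  fix a x assume *: "\<forall>a\<in>D. \<forall>x\<in>M. a * x \<in> M" "a \<in> D" "x \<in> (*) u ` M"
  then obtain m where "m \<in> M" "x = u * m" by auto
  with * show "a * x \<in> (*) u ` M" by (intro image_eqI[of _ _ "a * m"]) (auto simp: algebra_simps)
qed

lemma span_least: "submod M \<Longrightarrow> B \<subseteq> M \<Longrightarrow> span_over D B \<subseteq> M"
  unfolding span_over_def by (auto intro!: submod_sum submod_scale)

lemma span_superset: "B \<subseteq> span_over D B"
  by (rule span_over_superset[OF one_in])

lemma span_finite:
  assumes "finite B"
  shows "span_over D B = {\<Sum>b\<in>B. c b * b | c. \<forall>b\<in>B. c b \<in> D}"
proof
  show "span_over D B \<subseteq> {\<Sum>b\<in>B. c b * b | c. \<forall>b\<in>B. c b \<in> D}"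
  proof
    fix x assume "x \<in> span_over D B"
    then obtain F c where F: "finite F" "F \<subseteq> B" "\<forall>b\<in>F. c b \<in> D"
      and x: "x = (\<Sum>b\<in>F. c b * b)" unfolding span_over_def by blast
    have "x = (\<Sum>b\<in>B. (if b \<in> F then c b else 0) * b)"
      unfolding x using F assms by (intro sum.mono_neutral_cong_left) auto
    then show "x \<in> {\<Sum>b\<in>B. c b * b | c. \<forall>b\<in>B. c b \<in> D}"
      using F zero_in by (intro CollectI exI[of _ "\<lambda>b. if b \<in> F then c b else 0"]) auto
  qed
qed (use assms in \<open>auto simp: span_over_def\<close>)

lemma span_finiteE:
  assumes "x \<in> span_over D B" "finite B"
  obtains c where "\<forall>b\<in>B. c b \<in> D" "x = (\<Sum>b\<in>B. c b * b)"
  using assms by (auto simp: span_finite)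

lemma submod_span: "submod (span_over D B)"
  unfolding submod_def
proof (intro conjI ballI)
  show "0 \<in> span_over D B" unfolding span_over_def
    by (intro CollectI exI[of _ "{}"]) auto
next
  fix x y assume "x \<in> span_over D B" "y \<in> span_over D B"
  then obtain F G c d where F: "finite F" "F \<subseteq> B" "\<forall>b\<in>F. c b \<in> D" "x = (\<Sum>b\<in>F. c b * b)"
    and G: "finite G" "G \<subseteq> B" "\<forall>b\<in>G. d b \<in> D" "y = (\<Sum>b\<in>G. d b * b)"
    unfolding span_over_def by blast
  have "x \<in> span_over D (F \<union> G)" "y \<in> span_over D (F \<union> G)"
    unfolding span_over_def using F G by blast+
  with F(1) G(1) obtain c' d' where c': "\<forall>b\<in>F \<union> G. c' b \<in> D" "x = (\<Sum>b\<in>F \<union> G. c' b * b)"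
    and d': "\<forall>b\<in>F \<union> G. d' b \<in> D" "y = (\<Sum>b\<in>F \<union> G. d' b * b)"
    by (auto simp: span_finite)
  then have "x + y = (\<Sum>b\<in>F \<union> G. (c' b + d' b) * b)"
    by (simp add: sum.distrib algebra_simps)
  with c' d' F G show "x + y \<in> span_over D B" unfolding span_over_def
    by (intro CollectI exI[of _ "F \<union> G"] exI[of _ "\<lambda>b. c' b + d' b"]) (auto intro: add_in)
next
  fix a x assume "a \<in> D" "x \<in> span_over D B"
  then obtain F c where F: "finite F" "F \<subseteq> B" "\<forall>b\<in>F. c b \<in> D" "x = (\<Sum>b\<in>F. c b * b)"
    unfolding span_over_def by blast
  with \<open>a \<in> D\<close> show "a * x \<in> span_over D B" unfolding span_over_def
    by (intro CollectI exI[of _ F] exI[of _ "\<lambda>b. a * c b"])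
      (auto intro: mult_in simp: sum_distrib_left mult.assoc)
qed

lemma sum_in_span: "(\<And>b. b \<in> B \<Longrightarrow> c b \<in> D) \<Longrightarrow> (\<Sum>b\<in>B. c b * b) \<in> span_over D B"
  using span_superset by (auto intro!: submod_sum[OF submod_span] submod_scale[OF submod_span])

lemma span_mono: "B \<subseteq> C \<Longrightarrow> span_over D B \<subseteq> span_over D C"
  by (meson span_least submod_span span_superset order_trans)

lemma span_insert: "span_over D (insert x C) = {a * x + w | a w. a \<in> D \<and> w \<in> span_over D C}"
proof
  have "submod {a * x + w | a w. a \<in> D \<and> w \<in> span_over D C}" (is "submod ?M")
    unfolding submod_def
  proof (intro conjI ballI)
    show "0 \<in> ?M" using zero_in submod_zero[OF submod_span] by force
  next
    fix y z assume "y \<in> ?M" "z \<in> ?M"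
    then obtain a b v w where *: "y = a * x + v" "z = b * x + w" "a \<in> D" "b \<in> D"
      "v \<in> span_over D C" "w \<in> span_over D C" by blast
    then have "y + z = (a + b) * x + (v + w)" by (simp add: algebra_simps)
    with * show "y + z \<in> ?M" using add_in submod_add[OF submod_span] by blast
  next
    fix a y assume "a \<in> D" "y \<in> ?M"
    then obtain b v where *: "y = b * x + v" "b \<in> D" "v \<in> span_over D C" by blast
    then have "a * y = (a * b) * x + a * v" by (simp add: algebra_simps)
    with * show "a * y \<in> ?M" using mult_in submod_scale[OF submod_span] \<open>a \<in> D\<close> by blast
  qed
  moreover have "insert x C \<subseteq> ?M"
  proof -
    have "x = 1 * x + 0" and "\<And>c. c = 0 * x + c" by simp_all
    with one_in zero_in submod_zero[OF submod_span] span_superset show ?thesis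
      by (intro insert_subsetI) blast+
  qed
  ultimately show "span_over D (insert x C) \<subseteq> ?M" by (rule span_least)
  show "?M \<subseteq> span_over D (insert x C)"
    using span_mono[of C "insert x C"] span_superset[of "insert x C"]
    by (auto intro!: submod_add[OF submod_span] submod_scale[OF submod_span])
qed

text \<open>Serves to push a module into a smaller one by a nonzero factor and to return with the
  inverse factor, carrying generators along.\<close>

lemma span_image_mult: "span_over D ((*) u ` B) = (*) u ` span_over D B"
proof
  show "span_over D ((*) u ` B) \<subseteq> (*) u ` span_over D B"
    using span_superset by (intro span_least submod_image_mult submod_span) auto
  show "(*) u ` span_over D B \<subseteq> span_over D ((*) u ` B)"
  proof (rule image_subsetI)
    fix x assume "x \<in> span_over D B"
    then obtain F c where F: "F \<subseteq> B" "\<forall>b\<in>F. c b \<in> D" "x = (\<Sum>b\<in>F. c b * b)"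
      unfolding span_over_def by blast
    have "u * x = (\<Sum>b\<in>F. c b * (u * b))" by (simp add: F sum_distrib_left algebra_simps)
    also have "\<dots> \<in> span_over D ((*) u ` B)"
    proof (rule submod_sum[OF submod_span])
      fix b assume "b \<in> F"
      then have "c b \<in> D" "u * b \<in> span_over D ((*) u ` B)"
        using F span_superset[of "(*) u ` B"] by auto
      then show "c b * (u * b) \<in> span_over D ((*) u ` B)" by (rule submod_scale[OF submod_span])
    qed
    finally show "u * x \<in> span_over D ((*) u ` B)" .
  qed
qed

section \<open>Linear independence and change of basis\<close>

definition indep :: "'k set \<Rightarrow> bool" where
  "indep B \<longleftrightarrow> (\<forall>c. (\<forall>b\<in>B. c b \<in> D) \<and> (\<Sum>b\<in>B. c b * b) = 0 \<longrightarrow> (\<forall>b\<in>B. c b = 0))"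

lemma indepD:
  "indep B \<Longrightarrow> \<forall>b\<in>B. c b \<in> D \<Longrightarrow> (\<Sum>b\<in>B. c b * b) = 0 \<Longrightarrow> b \<in> B \<Longrightarrow> c b = 0"
  unfolding indep_def by blast

lemma is_basis_iff: "is_basis_over D M B \<longleftrightarrow> finite B \<and> span_over D B = M \<and> indep B"
  by (simp add: is_basis_over_def indep_def)

text \<open>Over a ring a relation cannot be divided by the coefficient of \<open>x\<close>. The
  condition therefore concerns all multiples \<open>a * x\<close> and not only \<open>x\<close>
  itself.\<close>

lemma indep_insert:
  assumes "finite C" "x \<notin> C"
  shows "indep (insert x C) \<longleftrightarrow> indep C \<and> (\<forall>a\<in>D. a * x \<in> span_over D C \<longrightarrow> a = 0)"
proof (intro iffI conjI ballI impI)
  assume ind: "indep (insert x C)"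
  show "indep C" unfolding indep_def
  proof (intro allI impI)
    fix c assume c: "(\<forall>b\<in>C. c b \<in> D) \<and> (\<Sum>b\<in>C. c b * b) = 0"
    have "(\<Sum>b\<in>insert x C. (c(x := 0)) b * b) = (\<Sum>b\<in>C. c b * b)"
      using assms by (auto intro!: sum.cong)
    with c have "\<forall>b\<in>insert x C. (c(x := 0)) b = 0"
      using indepD[OF ind, of "c(x := 0)"] zero_in by (auto simp del: sum.insert)
    with assms show "\<forall>b\<in>C. c b = 0" by (metis fun_upd_other insertI2)
  qed
  fix a assume a: "a \<in> D" "a * x \<in> span_over D C"
  then obtain c where c: "\<forall>b\<in>C. c b \<in> D" "a * x = (\<Sum>b\<in>C. c b * b)"
    using assms by (auto simp: span_finite)
  have "(\<Sum>b\<in>insert x C. (c(x := - a)) b * b) = - a * x + (\<Sum>b\<in>C. c b * b)"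
    using assms by (auto intro!: sum.cong)
  with c have "(\<Sum>b\<in>insert x C. (c(x := - a)) b * b) = 0" by simp
  then have "(c(x := - a)) x = 0"
    using indepD[OF ind, of "c(x := - a)" x] c a uminus_in by (auto simp del: sum.insert)
  then show "a = 0" by simp
next
  assume *: "indep C \<and> (\<forall>a\<in>D. a * x \<in> span_over D C \<longrightarrow> a = 0)"
  show "indep (insert x C)" unfolding indep_def
  proof (intro allI impI)
    fix c assume c: "(\<forall>b\<in>insert x C. c b \<in> D) \<and> (\<Sum>b\<in>insert x C. c b * b) = 0"
    then have eq: "c x * x = - (\<Sum>b\<in>C. c b * b)" using assms by (simp add: eq_neg_iff_add_eq_0)
    also have "\<dots> \<in> span_over D C" using c span_superset
      by (intro submod_uminus[OF submod_span] submod_sum[OF submod_span]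
          submod_scale[OF submod_span]) auto
    finally have "c x = 0" using * c by auto
    moreover have "\<forall>b\<in>C. c b = 0" using * c eq \<open>c x = 0\<close> unfolding indep_def by auto
    ultimately show "\<forall>b\<in>insert x C. c b = 0" by simp
  qed
qed

lemma indep_empty: "indep {}" by (simp add: indep_def)

lemma indep_image_mult:
  assumes "indep B" "u \<noteq> 0" shows "indep ((*) u ` B)"
  unfolding indep_def
proof (intro allI impI)
  fix c assume c: "(\<forall>b\<in>(*) u ` B. c b \<in> D) \<and> (\<Sum>b\<in>(*) u ` B. c b * b) = 0"
  have "(\<Sum>b\<in>(*) u ` B. c b * b) = u * (\<Sum>b\<in>B. c (u * b) * b)"
    using assms(2) by (subst sum.reindex) (auto simp: inj_on_def sum_distrib_left algebra_simps)
  with c assms(2) have "(\<Sum>b\<in>B. c (u * b) * b) = 0" by simp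
  then have "\<forall>b\<in>B. c (u * b) = 0" using c assms(1) unfolding indep_def by auto
  then show "\<forall>b\<in>(*) u ` B. c b = 0" by auto
qed

lemma indep_coords_eq:
  assumes "indep E" "\<forall>x\<in>E. c x \<in> D" "\<forall>x\<in>E. c' x \<in> D" "(\<Sum>x\<in>E. c x * x) = (\<Sum>x\<in>E. c' x * x)"
    and "x \<in> E"
  shows "c x = c' x"
proof -
  have "(\<Sum>x\<in>E. (c x - c' x) * x) = 0"
    using assms(4) by (simp add: sum_subtractf algebra_simps)
  then have "c x - c' x = 0"
    by (rule indepD[OF assms(1), rotated]) (use assms diff_in in auto)
  then show ?thesis by simp
qed

text \<open>Modulo the span of \<open>C\<close> the vectors \<open>x\<close> and
  \<open>x + q\<close> agree, so the same multiples of them fall into that span. This is the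
  elementary transformation of the reduction to diagonal form.\<close>

lemma basis_shear:
  assumes C: "finite C" "x \<notin> C" "indep (insert x C)" and q: "q \<in> span_over D C"
  shows "x + q \<notin> C" "indep (insert (x + q) C)"
    "span_over D (insert (x + q) C) = span_over D (insert x C)"
proof -
  have iff: "a * (x + q) \<in> span_over D C \<longleftrightarrow> a * x \<in> span_over D C" if "a \<in> D" for a
    using submod_add[OF submod_span submod_scale[OF submod_span that q], of "a * x"]
      submod_diff[OF submod_span _ submod_scale[OF submod_span that q], of "a * (x + q)"]
    by (auto simp: algebra_simps)
  have *: "indep C" "\<And>a. a \<in> D \<Longrightarrow> a * x \<in> span_over D C \<Longrightarrow> a = 0"
    using C indep_insert by auto
  show new: "x + q \<notin> C"
    using iff[OF one_in] *(2)[OF one_in] span_superset[of C] by auto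
  show "indep (insert (x + q) C)"
    using C(1) new * iff by (subst indep_insert) auto
  have "x + q \<in> span_over D (insert x C)" "x \<in> span_over D (insert (x + q) C)"
    using q span_superset[of "insert x C"] span_mono[of C "insert x C"]
      submod_diff[OF submod_span, of "x + q" "insert (x + q) C" q]
      span_superset[of "insert (x + q) C"] span_mono[of C "insert (x + q) C"]
    by (auto intro!: submod_add[OF submod_span])
  then show "span_over D (insert (x + q) C) = span_over D (insert x C)"
    using span_superset[of "insert x C"] span_superset[of "insert (x + q) C"]
    by (intro subset_antisym span_least submod_span) auto
qed

end

section \<open>Submodules of free modules over a Euclidean subring\<close>

locale euclidean_subdomain = subdomain +
  fixes \<delta> :: "'a \<Rightarrow> nat"
  assumes division: "a \<in> D \<Longrightarrow> b \<in> D \<Longrightarrow> b \<noteq> 0 \<Longrightarrow> \<exists>q\<in>D. a - q * b = 0 \<or> \<delta> (a - q * b) < \<delta> b"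
begin

text \<open>Among all bases of \<open>M\<close> and all elements of \<open>N\<close>, a nonzero coordinate \<open>a\<close> of minimal size
  divides every other coordinate of its element and the same coordinate of every element of \<open>N\<close>.
  After a shear the element is \<open>a\<close> times a basis vector, which splits off.\<close>

lemma stacked_bases:
  assumes "finite B" "indep B" "span_over D B = M" "submod N" "N \<subseteq> M"
  obtains E d Y where "finite E" "indep E" "span_over D E = M" "\<forall>x\<in>E. d x \<in> D"
    "N = {\<Sum>x\<in>E. c x * (d x * x) | c. \<forall>x\<in>E. c x \<in> D}"
    "finite Y" "indep Y" "span_over D Y = N"
proof -
  \<comment> \<open>\<open>Y\<close> is carried along separately: some \<open>d x\<close> may be 0,
    so the products \<open>d x * x\<close> need not form a basis of \<open>N\<close>.\<close>
  have "\<exists>E d Y. finite E \<and> indep E \<and> span_over D E = M \<and> (\<forall>x\<in>E. d x \<in> D) \<and>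
     N = {\<Sum>x\<in>E. c x * (d x * x) | c. \<forall>x\<in>E. c x \<in> D} \<and>
     finite Y \<and> indep Y \<and> span_over D Y = N"
    if "card B = n" for n using that assms
  proof (induction n arbitrary: B M N)
    case 0
    then have "B = {}" by simp
    moreover have "N = {0}" using 0 \<open>B = {}\<close> submod_zero[of N] by (auto simp: span_finite)
    ultimately show ?case using 0
      by (intro exI[of _ "{}"] exI[of _ "\<lambda>_. 0"]) (auto simp: span_finite zero_in)
  next
    case (Suc n)
    note N = Suc.prems(5,6)
    show ?case
    proof (cases "N = {0}")
      case True
      have "N = {\<Sum>x\<in>B. c x * (0 * x) | c. \<forall>x\<in>B. c x \<in> D}" using True zero_in by auto
      moreover have "span_over D {} = N" using True by (simp add: span_finite)
      ultimately show ?thesis using Suc.prems indep_empty zero_in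
        by (intro exI[of _ B] exI[of _ "\<lambda>_. 0"] exI[of _ "{}"]) simp
    next
      case False
      \<comment> \<open>\<open>P a x C y\<close> singles out a basis vector \<open>x\<close> of a
        basis \<open>insert x C\<close> of \<open>M\<close>, together with an element
        \<open>y\<close> of \<open>N\<close> whose coordinate at \<open>x\<close> is
        \<open>a\<close>, nonzero.\<close>
      define P where "P a x C y \<longleftrightarrow> finite C \<and> card C = n \<and> x \<notin> C \<and> indep (insert x C) \<and>
        span_over D (insert x C) = M \<and> y \<in> N \<and> a \<in> D \<and> a \<noteq> 0 \<and> y - a * x \<in> span_over D C"
        for a x C y
      have "\<exists>a x C y. P a x C y"
      proof -
        obtain y where y: "y \<in> N" "y \<noteq> 0" using False N submod_zero by blast
        then have "y \<in> span_over D B" using N Suc.prems by auto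
        then obtain c where c: "\<forall>b\<in>B. c b \<in> D" "y = (\<Sum>b\<in>B. c b * b)"
          using Suc.prems(2) by (rule span_finiteE)
        have "\<not> (\<forall>x\<in>B. c x = 0)" 
        proof
          assume "\<forall>x\<in>B. c x = 0"
          then have "y = 0" unfolding c(2) by (intro sum.neutral) auto
          with y(2) show False by simp
        qed
        then obtain x where x: "x \<in> B" "c x \<noteq> 0" by blast
        have "y - c x * x = (\<Sum>b\<in>B - {x}. c b * b)"
          unfolding c(2) by (subst sum.remove[OF Suc.prems(2) x(1)]) simp
        then have "y - c x * x \<in> span_over D (B - {x})"
          using c(1) by (auto intro: sum_in_span)
        with x c(1) y(1) Suc.prems(1-4) have "P (c x) x (B - {x}) y"
          unfolding P_def by (simp add: insert_absorb)
        then show ?thesis by blast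
      qed
      then obtain a0 x0 C0 y0 where "P a0 x0 C0 y0" by blast
      \<comment> \<open>The four data are packed into one tuple so that \<open>\<delta> a\<close> is
        minimised over all bases and all elements of \<open>N\<close> at once.\<close>
      from ex_has_least_nat[of "\<lambda>t. P (fst t) (fst (snd t)) (fst (snd (snd t))) (snd (snd (snd t)))"
          "(a0, x0, C0, y0)" "\<lambda>t. \<delta> (fst t)"] this
      obtain t where t: "P (fst t) (fst (snd t)) (fst (snd (snd t))) (snd (snd (snd t)))"
        "\<And>t'. P (fst t') (fst (snd t')) (fst (snd (snd t'))) (snd (snd (snd t'))) \<Longrightarrow>
          \<delta> (fst t) \<le> \<delta> (fst t')" unfolding fst_conv snd_conv by blast
      obtain a x C y where t_eq: "t = (a, x, C, y)" by (cases t)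
      have P: "P a x C y" using t(1) by (simp add: t_eq)
      have least: "\<delta> a \<le> \<delta> a'" if "P a' x' C' y'" for a' x' C' y'
        using t(2)[of "(a', x', C', y')"] that by (simp add: t_eq)
      from P have C: "finite C" "card C = n" "x \<notin> C" "indep (insert x C)"
        "span_over D (insert x C) = M" and y: "y \<in> N" and a: "a \<in> D" "a \<noteq> 0"
        and yx: "y - a * x \<in> span_over D C" unfolding P_def by auto
      obtain c where c: "\<forall>b\<in>C. c b \<in> D" "y - a * x = (\<Sum>b\<in>C. c b * b)"
        using yx C(1) by (rule span_finiteE)
      have "\<exists>q\<in>D. c b = q * a" if b: "b \<in> C" for b
      proof (rule ccontr)
        assume no: "\<not> (\<exists>q\<in>D. c b = q * a)"
        obtain q where q: "q \<in> D" "c b - q * a = 0 \<or> \<delta> (c b - q * a) < \<delta> a"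
          using division c(1) b a by blast
        define r where "r = c b - q * a"
        have r: "r \<noteq> 0" "r \<in> D" "\<delta> r < \<delta> a"
          using q no a c(1) b mult_in diff_in unfolding r_def by auto
        \<comment> \<open>Trading \<open>x\<close> for \<open>x + q * b\<close> changes the
          coordinate of \<open>y\<close> at \<open>b\<close> from \<open>c b\<close> to the
          remainder \<open>r\<close>. With \<open>b\<close> as the distinguished vector this is a
          nonzero coordinate smaller than \<open>a\<close>.\<close>
        define x' where "x' = x + q * b"
        have "q * b \<in> span_over D C"
          using q b span_superset submod_scale[OF submod_span] by blast
        note sh = basis_shear[OF C(1,3,4) this, folded x'_def]
        define C' where "C' = insert x' (C - {b})"
        have ins: "insert b C' = insert x' C" using b C'_def by auto
        have bC': "b \<notin> C'" using sh(1) b by (auto simp: C'_def)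
        have "card C' = n" using C(1,2) b sh(1) card_Suc_Diff1[OF C(1) b] unfolding C'_def by simp
        have "y - r * b = a * x' + (\<Sum>b\<in>C - {b}. c b * b)"
        proof -
          have "y = a * x + (\<Sum>b\<in>C. c b * b)" using c(2) by (simp add: algebra_simps)
          also have "\<dots> = a * x + c b * b + (\<Sum>b\<in>C - {b}. c b * b)"
            using b C(1) by (simp add: sum.remove[of C b])
          finally show ?thesis by (simp add: x'_def r_def algebra_simps)
        qed
        also have "\<dots> \<in> span_over D C'" using c(1) a(1) span_superset[of C']
          by (intro submod_add[OF submod_span] submod_sum[OF submod_span]
              submod_scale[OF submod_span]) (auto simp: C'_def)
        finally have "P r b C' y"
          unfolding P_def ins using r y bC' sh C \<open>card C' = n\<close> by (auto simp: C'_def)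
        from least[OF this] r show False by simp
      qed
      then obtain q where q: "\<And>b. b \<in> C \<Longrightarrow> q b \<in> D \<and> c b = q b * a" by metis
      \<comment> \<open>All other coordinates of \<open>y\<close> are multiples
        \<open>q b * a\<close>, so a single shear absorbs them and leaves
        \<open>y = a * x1\<close>.\<close>
      define x1 where "x1 = x + (\<Sum>b\<in>C. q b * b)"
      have "(\<Sum>b\<in>C. q b * b) \<in> span_over D C" using q by (auto intro: sum_in_span)
      note sh = basis_shear[OF C(1,3,4) this, folded x1_def]
      have "y = a * x + (\<Sum>b\<in>C. c b * b)" using c(2) by (simp add: algebra_simps)
      also have "(\<Sum>b\<in>C. c b * b) = (\<Sum>b\<in>C. (q b * a) * b)" by (intro sum.cong) (auto simp: q)
      finally have yx1: "y = a * x1" by (simp add: x1_def sum_distrib_left algebra_simps)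
      define N' where "N' = N \<inter> span_over D C"
      \<comment> \<open>Second use of minimality: \<open>z - p * y\<close> has coordinate
        \<open>e - p * a\<close> at \<open>x1\<close>, which is zero or smaller than
        \<open>a\<close>, hence zero.\<close>
      have N_split: "\<exists>e\<in>D. z - e * (a * x1) \<in> N'" if z: "z \<in> N" for z
      proof -
        have "z \<in> span_over D (insert x1 C)" using z N sh C by auto
        then obtain e w where e: "e \<in> D" "w \<in> span_over D C" "z = e * x1 + w"
          by (auto simp: span_insert)
        obtain p where p: "p \<in> D" "e - p * a = 0 \<or> \<delta> (e - p * a) < \<delta> a"
          using division e a by blast
        have zpN: "z - p * y \<in> N" using z y p N submod_diff submod_scale by blast
        have zp: "z - p * y - (e - p * a) * x1 = w" using e yx1 by (simp add: algebra_simps)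
        have "e - p * a = 0"
        proof (rule ccontr)
          assume "e - p * a \<noteq> 0"
          then have "P (e - p * a) x1 C (z - p * y)" unfolding P_def zp
            using C sh e p a zpN mult_in diff_in by auto
          from least[OF this] p \<open>e - p * a \<noteq> 0\<close> show False by simp
        qed
        with zp e(2) zpN yx1 p show ?thesis by (auto simp: N'_def)
      qed
      have N_eq: "N = {e * (a * x1) + w | e w. e \<in> D \<and> w \<in> N'}"
      proof
        show "N \<subseteq> {e * (a * x1) + w | e w. e \<in> D \<and> w \<in> N'}"
        proof
          fix z assume "z \<in> N"
          from N_split[OF this] obtain e where "e \<in> D" "z - e * (a * x1) \<in> N'" by blast
          moreover have "z = e * (a * x1) + (z - e * (a * x1))" by simp
          ultimately show "z \<in> {e * (a * x1) + w | e w. e \<in> D \<and> w \<in> N'}" by blast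
        qed
        show "{e * (a * x1) + w | e w. e \<in> D \<and> w \<in> N'} \<subseteq> N"
          using y N by (auto simp: yx1 N'_def intro!: submod_add submod_scale)
      qed
      have "submod N'" using N submod_Int submod_span by (simp add: N'_def)
      have indC: "indep C" and x1: "\<And>e. e \<in> D \<Longrightarrow> e * x1 \<in> span_over D C \<Longrightarrow> e = 0"
        using indep_insert[OF C(1) sh(1)] sh(2) by auto
      obtain E d Y where E: "finite E" "indep E" "span_over D E = span_over D C" "\<forall>x\<in>E. d x \<in> D"
        and N': "N' = {\<Sum>x\<in>E. c x * (d x * x) | c. \<forall>x\<in>E. c x \<in> D}"
        and Y: "finite Y" "indep Y" "span_over D Y = N'"
        using Suc.IH[OF C(2,1) indC refl \<open>submod N'\<close>] unfolding N'_def by blast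
      have x1X: "x1 \<notin> E" using x1[of 1] one_in span_superset[of E] E by auto
      have ax1Y: "a * x1 \<notin> Y" using x1[of a] a span_superset[of Y] Y N'_def by auto
      have 1: "finite (insert x1 E)" "indep (insert x1 E)" using x1X E x1 by (simp_all add: indep_insert)
      have 2: "span_over D (insert x1 E) = M"
        unfolding C(5)[symmetric] sh(3)[symmetric] by (simp add: span_insert E)
      have 3: "finite (insert (a * x1) Y)" using Y by simp
      have 4: "indep (insert (a * x1) Y)"
      proof -
        have "e = 0" if "e \<in> D" "e * (a * x1) \<in> span_over D Y" for e
          using x1[of "e * a"] that Y a mult_in by (auto simp: N'_def mult.assoc)
        with ax1Y Y show ?thesis by (simp add: indep_insert)
      qed
      have 5: "span_over D (insert (a * x1) Y) = N"
        unfolding N_eq by (simp add: span_insert Y)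
      have 6: "\<forall>x\<in>insert x1 E. (d(x1 := a)) x \<in> D" using E a by auto
      have 7: "N = {\<Sum>x\<in>insert x1 E. c x * ((d(x1 := a)) x * x) | c. \<forall>x\<in>insert x1 E. c x \<in> D}"
        (is "N = ?S")
      proof -
        have sum_eq: "(\<Sum>x\<in>insert x1 E. c x * ((d(x1 := a)) x * x)) =
            c x1 * (a * x1) + (\<Sum>x\<in>E. c x * (d x * x))" for c
          using x1X E by (auto intro!: sum.cong)
        show ?thesis
        proof
          show "N \<subseteq> ?S"
          proof
            fix z assume "z \<in> N"
            then obtain e c where "e \<in> D" "\<forall>x\<in>E. c x \<in> D"
              and z: "z = e * (a * x1) + (\<Sum>x\<in>E. c x * (d x * x))"
              unfolding N_eq N' by blast
            moreover have "(\<Sum>x\<in>E. (c(x1 := e)) x * (d x * x)) = (\<Sum>x\<in>E. c x * (d x * x))"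
              using x1X by (intro sum.cong) auto
            ultimately show "z \<in> ?S" unfolding sum_eq
              by (intro CollectI exI[of _ "c(x1 := e)"]) simp
          qed
          show "?S \<subseteq> N" unfolding sum_eq unfolding N_eq N' by blast
        qed
      qed
      from 1 2 6 7 3 4 5 show ?thesis by blast
    qed
  qed
  from this[OF refl] show thesis by (elim exE conjE) (rule that)
qed

text \<open>If \<open>a x\<close> lies in the span of the other generators for some \<open>a \<noteq> 0\<close>, then \<open>a\<close> times the module
  is a submodule of a free module, hence free.\<close>

lemma finite_span_has_basis:
  assumes "finite B"
  shows "\<exists>E. is_basis_over D (span_over D B) E"
  using assms
proof induction
  case empty
  show ?case using indep_empty by (auto simp: is_basis_iff)
next
  case (insert x B)
  then obtain C where C: "finite C" "span_over D C = span_over D B" "indep C"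
    by (auto simp: is_basis_iff)
  show ?case
  proof (cases "\<exists>a\<in>D. a \<noteq> 0 \<and> a * x \<in> span_over D B")
    case True
    then obtain a where a: "a \<in> D" "a \<noteq> 0" "a * x \<in> span_over D B" by blast
    let ?N = "(*) a ` span_over D (insert x B)"
    have "?N \<subseteq> span_over D B"
      unfolding span_image_mult[symmetric]
      using a span_superset[of B] by (intro span_least submod_span) (auto intro: submod_scale submod_span)
    then obtain Y where Y: "finite Y" "indep Y" "span_over D Y = ?N"
      using stacked_bases[OF C(1,3,2) submod_image_mult[OF submod_span]] by metis
    have "span_over D ((*) (inverse a) ` Y) = span_over D (insert x B)"
      using a by (simp add: span_image_mult Y image_image mult.assoc[symmetric])
    moreover have "indep ((*) (inverse a) ` Y)" using indep_image_mult Y a by simp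
    ultimately show ?thesis using Y by (auto simp: is_basis_iff)
  next
    case False
    then have "x \<notin> C" using one_in span_superset[of C] C by force
    with False C have "is_basis_over D (span_over D (insert x B)) (insert x C)"
      by (auto simp: is_basis_iff indep_insert span_insert)
    then show ?thesis by blast
  qed
qed

end

section \<open>Quotient modules and order ideals\<close>

lemma type_algebra_simps [simp]:
  "carrier ring_of_type_algebra = UNIV" "x \<otimes>\<^bsub>ring_of_type_algebra\<^esub> y = x * y"
  "\<one>\<^bsub>ring_of_type_algebra\<^esub> = 1" "\<zero>\<^bsub>ring_of_type_algebra\<^esub> = 0"
  "x \<oplus>\<^bsub>ring_of_type_algebra\<^esub> y = x + y"
  by (simp_all add: ring_of_type_algebra_def)

lemma type_algebra_uminus [simp]: "\<ominus>\<^bsub>ring_of_type_algebra\<^esub> x = - (x :: 'a::comm_ring_1)"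
proof -
  interpret cring "ring_of_type_algebra :: 'a ring" by (rule cring_from_type_algebra)
  show ?thesis using minus_equality[of "- x" x] by simp
qed

section \<open>Ideals of a commutative ring and their products\<close>

lemma ideal_type_algebraD:
  assumes "ideal I (ring_of_type_algebra :: 'a::comm_ring_1 ring)"
  shows "0 \<in> I" "x \<in> I \<Longrightarrow> y \<in> I \<Longrightarrow> x + y \<in> I" "x \<in> I \<Longrightarrow> - x \<in> I" "x \<in> I \<Longrightarrow> r * x \<in> I"
proof -
  interpret ideal I "ring_of_type_algebra :: 'a ring" by (rule assms)
  show "0 \<in> I" using additive_subgroup.zero_closed[OF is_additive_subgroup] by simp
  show "x \<in> I \<Longrightarrow> y \<in> I \<Longrightarrow> x + y \<in> I" using additive_subgroup.a_closed[OF is_additive_subgroup, of x y] by simp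
  show "x \<in> I \<Longrightarrow> - x \<in> I" using I_l_closed[of x "- 1"] by simp
  show "x \<in> I \<Longrightarrow> r * x \<in> I" using I_l_closed[of x r] by simp
qed

definition multiples :: "'a::comm_monoid_mult \<Rightarrow> 'a set" where
  "multiples t = {a. t dvd a}"

lemma mem_multiples [simp]: "a \<in> multiples t \<longleftrightarrow> t dvd a"
  by (simp add: multiples_def)

lemma cgenideal_type_algebra:
  "cgenideal ring_of_type_algebra t = multiples (t :: 'a::comm_ring_1)"
  by (auto simp: cgenideal_def dvd_def mult.commute)

lemma ideal_multiples: "ideal (multiples t) (ring_of_type_algebra :: 'a::comm_ring_1 ring)"
proof -
  interpret cring "ring_of_type_algebra :: 'a ring" by (rule cring_from_type_algebra)
  show ?thesis using cgenideal_ideal[of t] by (simp add: cgenideal_type_algebra)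
qed

lemma multiples_one: "multiples 1 = UNIV"
  by auto

lemma ideal_prod_multiples:
  "multiples s \<cdot>\<^bsub>ring_of_type_algebra\<^esub> multiples t = multiples (s * t :: 'a::comm_ring_1)"
proof
  show "multiples s \<cdot>\<^bsub>ring_of_type_algebra\<^esub> multiples t \<subseteq> multiples (s * t)"
  proof
    fix x assume "x \<in> multiples s \<cdot>\<^bsub>ring_of_type_algebra\<^esub> multiples t"
    then show "x \<in> multiples (s * t)"
      by induction (auto intro: mult_dvd_mono)
  qed
  show "multiples (s * t) \<subseteq> multiples s \<cdot>\<^bsub>ring_of_type_algebra\<^esub> multiples t"
  proof
    fix x assume "x \<in> multiples (s * t)"
    then obtain r where x: "x = s * (t * r)" by (auto simp: dvd_def mult.assoc)
    show "x \<in> multiples s \<cdot>\<^bsub>ring_of_type_algebra\<^esub> multiples t"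
      using ideal_prod.prod[of s "multiples s" "t * r" "multiples t" ring_of_type_algebra]
      by (simp add: x)
  qed
qed

lemma comm_monoid_ideals_set: "comm_monoid (ideals_set (ring_of_type_algebra :: 'a::comm_ring_1 ring))"
  by (rule cring.ideals_set_is_comm_monoid[OF cring_from_type_algebra])

lemma pow_multiples:
  "multiples t [^]\<^bsub>ideals_set ring_of_type_algebra\<^esub> (n::nat) = multiples (t ^ n :: 'a::comm_ring_1)"
proof -
  interpret comm_monoid "ideals_set (ring_of_type_algebra :: 'a ring)"
    by (rule comm_monoid_ideals_set)
  show ?thesis
  proof (induction n)
    case 0
    then show ?case by (simp add: multiples_one) (simp add: ideals_set_def)
  next
    case (Suc n)
    then show ?case
      by (simp add: nat_pow_Suc) (simp add: ideals_set_def ideal_prod_multiples mult.commute)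
  qed
qed

lemma finprod_multiples:
  "finprod (ideals_set ring_of_type_algebra) (\<lambda>i. multiples (t i)) {..<n::nat} =
     multiples (\<Prod>i<n. t i :: 'a::comm_ring_1)"
proof -
  interpret comm_monoid "ideals_set (ring_of_type_algebra :: 'a ring)"
    by (rule comm_monoid_ideals_set)
  have carr: "multiples s \<in> carrier (ideals_set ring_of_type_algebra)" for s :: 'a
    by (simp add: ideals_set_def ideal_multiples)
  show ?thesis
  proof (induction n)
    case 0
    then show ?case by (simp add: multiples_one) (simp add: ideals_set_def)
  next
    case (Suc n)
    then show ?case using carr
      by (simp add: lessThan_Suc) (simp add: ideals_set_def ideal_prod_multiples)
  qed
qed

text \<open>A product of two ideals lies in their intersection. Membership in the carrier is proved
  along with the inclusions because the intersection fact requires the partial product to be an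
  ideal. The consequence of interest is that an element of the order ideal kills every cyclic
  summand.\<close>

lemma finprod_ideals_subset:
  fixes a :: "nat \<Rightarrow> 'a::comm_ring_1 set"
  assumes "\<forall>i<n. ideal (a i) ring_of_type_algebra"
  shows "finprod (ideals_set ring_of_type_algebra) a {..<n} \<in> carrier (ideals_set ring_of_type_algebra) \<and>
    (\<forall>i<n. finprod (ideals_set ring_of_type_algebra) a {..<n} \<subseteq> a i)"
  using assms
proof (induction n)
  case 0
  interpret comm_monoid "ideals_set (ring_of_type_algebra :: 'a ring)"
    by (rule comm_monoid_ideals_set)
  show ?case by simp
next
  case (Suc n)
  interpret comm_monoid "ideals_set (ring_of_type_algebra :: 'a ring)"
    by (rule comm_monoid_ideals_set)
  interpret rota: cring "ring_of_type_algebra :: 'a ring" by (rule cring_from_type_algebra)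
  let ?P = "finprod (ideals_set ring_of_type_algebra) a {..<n}"
  have carr: "a i \<in> carrier (ideals_set ring_of_type_algebra)" if "i < Suc n" for i
    using Suc.prems that by (simp add: ideals_set_def)
  have P: "ideal ?P ring_of_type_algebra" "\<forall>i<n. ?P \<subseteq> a i"
    using Suc by (auto simp: ideals_set_def)
  have eq: "finprod (ideals_set ring_of_type_algebra) a {..<Suc n} =
      a n \<cdot>\<^bsub>ring_of_type_algebra\<^esub> ?P"
    using carr by (simp add: lessThan_Suc Pi_def) (simp add: ideals_set_def)
  have "a n \<cdot>\<^bsub>ring_of_type_algebra\<^esub> ?P \<subseteq> a n \<inter> ?P"
    using Suc.prems P(1) by (intro rota.ideal_prod_inter) auto
  moreover have "ideal (a n \<cdot>\<^bsub>ring_of_type_algebra\<^esub> ?P) ring_of_type_algebra"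
    using Suc.prems P(1) by (intro rota.ideal_prod_is_ideal) auto
  ultimately show ?case unfolding eq using P(2) by (auto simp: ideals_set_def less_Suc_eq)
qed

text \<open>Built from the addition of the type instead of a record, so that the same cosets serve
  S/R, the quotients of A by its ideals, and the residue classes of A[x] modulo f.\<close>

definition coset :: "'x::ab_group_add set \<Rightarrow> 'x \<Rightarrow> 'x set" where
  "coset N x = (\<lambda>h. h + x) ` N"

text \<open>The laws are imposed on the whole type and not on the carrier of \<open>M\<close>; for
  an order they hold throughout the field, whichever subset the carrier is.\<close>

locale quotient_setup =
  fixes M :: "('a::comm_ring_1, 'x::ab_group_add, 'm) module_scheme" and N :: "'x set"
  assumes add_eq: "add M = (+)"
    and smult_distrib: "r \<odot>\<^bsub>M\<^esub> (x + y) = r \<odot>\<^bsub>M\<^esub> x + r \<odot>\<^bsub>M\<^esub> y"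
    and zero_smult: "0 \<odot>\<^bsub>M\<^esub> x = 0"
    and N_zero: "0 \<in> N" and N_add: "x \<in> N \<Longrightarrow> y \<in> N \<Longrightarrow> x + y \<in> N"
    and N_uminus: "x \<in> N \<Longrightarrow> - x \<in> N" and N_smult: "x \<in> N \<Longrightarrow> r \<odot>\<^bsub>M\<^esub> x \<in> N"
begin

lemma N_diff: "x \<in> N \<Longrightarrow> y \<in> N \<Longrightarrow> x - y \<in> N"
  using N_add[of x "- y"] N_uminus[of y] by simp

lemma coset_eq_iff: "coset N x = coset N y \<longleftrightarrow> x - y \<in> N"
proof
  assume "coset N x = coset N y"
  moreover have "0 + x \<in> coset N x" unfolding coset_def using N_zero by blast
  ultimately obtain h where "h \<in> N" "x = h + y" by (auto simp: coset_def)
  then show "x - y \<in> N" by simp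
next
  assume xy: "x - y \<in> N"
  show "coset N x = coset N y"
  proof (intro Set.set_eqI iffI)
    fix z assume "z \<in> coset N x"
    then obtain h where "h \<in> N" "z = h + x" by (auto simp: coset_def)
    then have "z = (h + (x - y)) + y" "h + (x - y) \<in> N" using xy N_add by auto
    then show "z \<in> coset N y" unfolding coset_def by blast
  next
    fix z assume "z \<in> coset N y"
    then obtain h where "h \<in> N" "z = h + y" by (auto simp: coset_def)
    then have "z = (h - (x - y)) + x" "h - (x - y) \<in> N" using xy N_diff by auto
    then show "z \<in> coset N x" unfolding coset_def by blast
  qed
qed

lemma coset_zero: "coset N 0 = N"
  by (simp add: coset_def)

lemma coset_eq_N_iff: "coset N x = N \<longleftrightarrow> x \<in> N"
  using coset_eq_iff[of x 0] by (simp add: coset_zero)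

lemma a_r_coset_eq: "N +>\<^bsub>M\<^esub> x = coset N x"
  by (auto simp: a_r_coset_def' coset_def add_eq)

lemma carrier_quotient: "carrier (quotient_module M N) = coset N ` carrier M"
  by (auto simp: quotient_module_def A_RCOSETS_def' a_r_coset_eq)

text \<open>Scalar multiplication in \<open>quotient_module\<close>, like the map \<open>h\<close>
  built below, is a union over all representatives. Where the value does not depend on the
  representative, the union collapses to it.\<close>

lemma coset_UN:
  assumes "\<And>h. h \<in> N \<Longrightarrow> g (h + x) = g x"
  shows "(\<Union>y\<in>coset N x. g y) = g x"
  unfolding coset_def using assms N_zero by auto

lemma add_quotient: "coset N x \<oplus>\<^bsub>quotient_module M N\<^esub> coset N y = coset N (x + y)"
proof -
  have "coset N x <+>\<^bsub>M\<^esub> coset N y = coset N (x + y)"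
  proof (intro Set.set_eqI iffI)
    fix z assume "z \<in> coset N x <+>\<^bsub>M\<^esub> coset N y"
    then obtain h k where "h \<in> N" "k \<in> N" "z = (h + x) + (k + y)"
      by (auto simp: set_add_def' coset_def add_eq)
    then have "z = (h + k) + (x + y)" "h + k \<in> N" by (auto simp: N_add algebra_simps)
    then show "z \<in> coset N (x + y)" unfolding coset_def by blast
  next
    fix z assume "z \<in> coset N (x + y)"
    then obtain h where "h \<in> N" "z = (h + x) + (0 + y)" by (auto simp: coset_def algebra_simps)
    then show "z \<in> coset N x <+>\<^bsub>M\<^esub> coset N y"
      unfolding set_add_def' coset_def add_eq using N_zero by blast
  qed
  then show ?thesis by (simp add: quotient_module_def)
qed

lemma smult_quotient: "r \<odot>\<^bsub>quotient_module M N\<^esub> coset N x = coset N (r \<odot>\<^bsub>M\<^esub> x)"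
proof -
  have "(\<Union>y\<in>coset N x. coset N (r \<odot>\<^bsub>M\<^esub> y)) = coset N (r \<odot>\<^bsub>M\<^esub> x)"
    by (rule coset_UN) (simp add: coset_eq_iff smult_distrib N_smult)
  then show ?thesis by (simp add: quotient_module_def a_r_coset_eq)
qed

end

lemma quotient_setup_regular:
  assumes "ideal I (ring_of_type_algebra :: 'a::comm_ring_1 ring)"
  shows "quotient_setup (regular_module ring_of_type_algebra) I"
  using ideal_type_algebraD[OF assms]
  by unfold_locales (auto simp: regular_module_def ring_of_type_algebra_def distrib_left)

lemma smult_regular [simp]: "r \<odot>\<^bsub>regular_module ring_of_type_algebra\<^esub> x = r * x"
  and carrier_regular [simp]: "carrier (regular_module ring_of_type_algebra) = UNIV"
  by (simp_all add: regular_module_def)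

context quotient_setup
begin

text \<open>First isomorphism theorem in coordinates: \<kappa> maps the carrier of \<open>M\<close>
  onto n-tuples over A, and \<open>N\<close> is the preimage of the product of the
  \<open>a i\<close>. Hence M/N is the direct sum of the quotients of A by the
  \<open>a i\<close>.\<close>

lemma has_index_idealI:
  assumes a: "\<And>i. i < (n::nat) \<Longrightarrow> ideal (a i) (ring_of_type_algebra :: 'a ring)"
    "\<And>i. i < n \<Longrightarrow> a i \<noteq> {0}"
    and M: "N \<subseteq> carrier M" "\<And>x y. x \<in> carrier M \<Longrightarrow> y \<in> carrier M \<Longrightarrow> x + y \<in> carrier M"
      "\<And>x. x \<in> carrier M \<Longrightarrow> - x \<in> carrier M"
      "\<And>r x. x \<in> carrier M \<Longrightarrow> r \<odot>\<^bsub>M\<^esub> x \<in> carrier M"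
    and \<kappa>: "\<And>x y i. x \<in> carrier M \<Longrightarrow> y \<in> carrier M \<Longrightarrow> i < n \<Longrightarrow> \<kappa> (x + y) i = \<kappa> x i + \<kappa> y i"
      "\<And>r x i. x \<in> carrier M \<Longrightarrow> i < n \<Longrightarrow> \<kappa> (r \<odot>\<^bsub>M\<^esub> x) i = r * \<kappa> x i"
      "\<And>k. \<exists>x\<in>carrier M. \<forall>i<n. \<kappa> x i = k i"
      "\<And>x. x \<in> carrier M \<Longrightarrow> x \<in> N \<longleftrightarrow> (\<forall>i<n. \<kappa> x i \<in> a i)"
  shows "has_index_ideal ring_of_type_algebra M N (finprod (ideals_set ring_of_type_algebra) a {..<n})"
proof -
  have q: "quotient_setup (regular_module ring_of_type_algebra) (a i)" if "i < n" for i
    using quotient_setup_regular[OF a(1)[OF that]] .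
  define h where "h C = (\<lambda>i\<in>{..<n}. \<Union>x\<in>C. coset (a i) (\<kappa> x i))" for C
  have h_coset: "h (coset N x) = (\<lambda>i\<in>{..<n}. coset (a i) (\<kappa> x i))" if x: "x \<in> carrier M" for x
  proof -
    have "(\<Union>x\<in>coset N x. coset (a i) (\<kappa> x i)) = coset (a i) (\<kappa> x i)" if i: "i < n" for i
    proof (rule coset_UN)
      fix k assume "k \<in> N"
      then show "coset (a i) (\<kappa> (k + x) i) = coset (a i) (\<kappa> x i)"
        using \<kappa>(1)[of k x i] \<kappa>(4)[of k] M(1) x i
        by (auto simp: quotient_setup.coset_eq_iff[OF q[OF i]])
    qed
    then show ?thesis unfolding h_def by (intro restrict_ext) auto
  qed
  let ?Q = "quotient_module M N"
  let ?A = "\<lambda>i. quotient_module (regular_module ring_of_type_algebra) (a i)"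
  let ?S = "direct_sum_module {..<n} ?A"
  have carrS: "carrier ?S = (\<Pi>\<^sub>E i\<in>{..<n}. range (coset (a i)))"
    by (auto simp: direct_sum_module_def quotient_setup.carrier_quotient[OF q] intro!: PiE_cong)
  have \<kappa>_diff: "\<kappa> (x - y) i = \<kappa> x i - \<kappa> y i" if "x \<in> carrier M" "y \<in> carrier M" "i < n" for x y i
    using \<kappa>(1)[of "x - y" y i] that M(2)[of x "- y"] M(3)[of y] by simp
  have M_diff: "x - y \<in> carrier M" if "x \<in> carrier M" "y \<in> carrier M" for x y
    using M(2)[of x "- y"] M(3)[of y] that by simp
  have "h \<in> hom (add_monoid ?Q) (add_monoid ?S)"
  proof (rule homI)
    fix C assume "C \<in> carrier (add_monoid ?Q)"
    then show "h C \<in> carrier (add_monoid ?S)"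
      by (auto simp: carrier_quotient h_coset carrS)
  next
    fix C C' assume "C \<in> carrier (add_monoid ?Q)" "C' \<in> carrier (add_monoid ?Q)"
    then obtain x y where xy: "x \<in> carrier M" "y \<in> carrier M" "C = coset N x" "C' = coset N y"
      by (auto simp: carrier_quotient)
    have "h (C \<oplus>\<^bsub>?Q\<^esub> C') = (\<lambda>i\<in>{..<n}. coset (a i) (\<kappa> (x + y) i))"
      by (simp add: xy add_quotient h_coset M)
    also have "\<dots> = (\<lambda>i\<in>{..<n}. h C i \<oplus>\<^bsub>?A i\<^esub> h C' i)"
      by (intro restrict_ext) (simp add: xy h_coset \<kappa> quotient_setup.add_quotient[OF q])
    also have "\<dots> = h C \<oplus>\<^bsub>?S\<^esub> h C'" by (simp add: direct_sum_module_def)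
    finally show "h (C \<otimes>\<^bsub>add_monoid ?Q\<^esub> C') = h C \<otimes>\<^bsub>add_monoid ?S\<^esub> h C'" by simp
  qed
  moreover have "bij_betw h (carrier ?Q) (carrier ?S)" unfolding bij_betw_def
  proof
    show "inj_on h (carrier ?Q)"
    proof (rule inj_onI)
      fix C C' assume "C \<in> carrier ?Q" "C' \<in> carrier ?Q" and eq: "h C = h C'"
      then obtain x y where xy: "x \<in> carrier M" "y \<in> carrier M" "C = coset N x" "C' = coset N y"
        by (auto simp: carrier_quotient)
      have "\<kappa> (x - y) i \<in> a i" if "i < n" for i
      proof -
        have "coset (a i) (\<kappa> x i) = coset (a i) (\<kappa> y i)"
          using fun_cong[OF eq, of i] xy that by (simp add: h_coset)
        then show ?thesis using \<kappa>_diff xy that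
          by (simp add: quotient_setup.coset_eq_iff[OF q[OF that]])
      qed
      then show "C = C'" using \<kappa>(4) xy M_diff by (simp add: coset_eq_iff)
    qed
    show "h ` carrier ?Q = carrier ?S"
    proof
      show "h ` carrier ?Q \<subseteq> carrier ?S" by (auto simp: carrier_quotient h_coset carrS)
      show "carrier ?S \<subseteq> h ` carrier ?Q"
      proof
        fix v assume v: "v \<in> carrier ?S"
        then have "\<forall>i<n. \<exists>k. v i = coset (a i) k" by (auto simp: carrS PiE_def Pi_def)
        then obtain k where k: "\<forall>i<n. v i = coset (a i) (k i)" by metis
        obtain x where x: "x \<in> carrier M" "\<forall>i<n. \<kappa> x i = k i" using \<kappa>(3) by blast
        have "v = h (coset N x)"
          using v k x by (auto simp: h_coset carrS fun_eq_iff PiE_def extensional_def restrict_def)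
        with x show "v \<in> h ` carrier ?Q" by (auto simp: carrier_quotient)
      qed
    qed
  qed
  ultimately have "h \<in> iso (add_monoid ?Q) (add_monoid ?S)" by (simp add: iso_def)
  moreover have "h (r \<odot>\<^bsub>?Q\<^esub> C) = r \<odot>\<^bsub>?S\<^esub> h C" if C: "C \<in> carrier ?Q" for r C
  proof -
    obtain x where x: "x \<in> carrier M" "C = coset N x" using C by (auto simp: carrier_quotient)
    have "h (r \<odot>\<^bsub>?Q\<^esub> C) = (\<lambda>i\<in>{..<n}. coset (a i) (\<kappa> (r \<odot>\<^bsub>M\<^esub> x) i))"
      by (simp add: x smult_quotient h_coset M)
    also have "\<dots> = (\<lambda>i\<in>{..<n}. r \<odot>\<^bsub>?A i\<^esub> h C i)"
      by (intro restrict_ext) (simp add: x h_coset \<kappa> quotient_setup.smult_quotient[OF q])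
    also have "\<dots> = r \<odot>\<^bsub>?S\<^esub> h C" by (simp add: direct_sum_module_def)
    finally show ?thesis .
  qed
  ultimately have "module_isomorphic ring_of_type_algebra ?Q ?S"
    unfolding module_isomorphic_def by blast
  with a show ?thesis unfolding has_index_ideal_def has_order_ideal_def
    by (intro exI[of _ n] exI[of _ a]) simp
qed

text \<open>For whichever decomposition witnesses the index ideal, \<open>r\<close> lies in every
  \<open>a i\<close>, hence kills the direct sum; the isomorphism transports this back to the
  quotient.\<close>

lemma index_ideal_annihilates:
  assumes I: "has_index_ideal ring_of_type_algebra M N I" and r: "r \<in> I" and x: "x \<in> carrier M"
    and M: "\<And>r. r \<odot>\<^bsub>M\<^esub> x \<in> carrier M"
  shows "r \<odot>\<^bsub>M\<^esub> x \<in> N"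
proof -
  let ?Q = "quotient_module M N"
  let ?S' = "\<lambda>n a. direct_sum_module {..<n::nat}
    (\<lambda>i. quotient_module (regular_module (ring_of_type_algebra :: 'a ring)) (a i))"
  obtain n a where a: "\<forall>i<n::nat. ideal (a i) (ring_of_type_algebra :: 'a ring)"
    and I_eq: "I = finprod (ideals_set ring_of_type_algebra) a {..<n}"
    and iso: "module_isomorphic ring_of_type_algebra ?Q (?S' n a)"
    using I unfolding has_index_ideal_def has_order_ideal_def by blast
  obtain h where h: "h \<in> iso (add_monoid ?Q) (add_monoid (?S' n a))"
    and smult: "\<And>s C. C \<in> carrier ?Q \<Longrightarrow> h (s \<odot>\<^bsub>?Q\<^esub> C) = s \<odot>\<^bsub>?S' n a\<^esub> h C"
    using iso unfolding module_isomorphic_def by auto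
  let ?A = "\<lambda>i. quotient_module (regular_module ring_of_type_algebra) (a i)"
  let ?S = "direct_sum_module {..<n} ?A"
  have q: "quotient_setup (regular_module ring_of_type_algebra) (a i)" if "i < n" for i
    using quotient_setup_regular a that by blast
  have ri: "r \<in> a i" if "i < n" for i
    using finprod_ideals_subset[OF a] r that unfolding I_eq by blast
  let ?C = "coset N x"
  have C: "?C \<in> carrier ?Q" using x by (simp add: carrier_quotient)
  have "h ?C \<in> carrier ?S" using h C by (auto simp: iso_def hom_def)
  then have hC: "h ?C i \<in> carrier (?A i)" if "i < n" for i
    using that by (auto simp: direct_sum_module_def PiE_def Pi_def)
  have "\<exists>y. h ?C i = coset (a i) y" if "i < n" for i
    using hC[OF that] by (auto simp: quotient_setup.carrier_quotient[OF q[OF that]])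
  then obtain y where y: "\<And>i. i < n \<Longrightarrow> h ?C i = coset (a i) (y i)" by metis
  \<comment> \<open>The comparison is with the multiple by the scalar 0 rather than with the zero
    element: both sides are then scalar multiples, so compatibility of \<open>h\<close> with scalars
    and injectivity finish the argument.\<close>
  have "r \<odot>\<^bsub>?A i\<^esub> h ?C i = 0 \<odot>\<^bsub>?A i\<^esub> h ?C i" if i: "i < n" for i
  proof -
    have "r * y i \<in> a i"
      using ideal_type_algebraD(4)[of "a i" r "y i"] a ri i by (simp add: mult.commute)
    then show ?thesis
      by (simp add: y i quotient_setup.smult_quotient[OF q[OF i]] quotient_setup.coset_eq_iff[OF q[OF i]])
  qed
  then have "r \<odot>\<^bsub>?S\<^esub> h ?C = 0 \<odot>\<^bsub>?S\<^esub> h ?C"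
    by (auto simp: direct_sum_module_def intro!: restrict_ext)
  then have "h (r \<odot>\<^bsub>?Q\<^esub> ?C) = h (0 \<odot>\<^bsub>?Q\<^esub> ?C)" by (simp add: smult[OF C])
  moreover have "inj_on h (carrier ?Q)" using h by (simp add: iso_def bij_betw_def)
  ultimately have "coset N (r \<odot>\<^bsub>M\<^esub> x) = coset N (0 \<odot>\<^bsub>M\<^esub> x)"
    using M by (auto simp: smult_quotient carrier_quotient dest: inj_onD)
  then show ?thesis by (simp add: coset_eq_iff zero_smult)
qed

end

section \<open>Orders over a Euclidean ring embedded in a field\<close>

lemma subring_type_algebra_iff:
  "subring S (ring_of_type_algebra :: 'k::field ring) \<longleftrightarrow>
     1 \<in> S \<and> (\<forall>x\<in>S. - x \<in> S) \<and> (\<forall>x\<in>S. \<forall>y\<in>S. x * y \<in> S) \<and> (\<forall>x\<in>S. \<forall>y\<in>S. x + y \<in> S)"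
proof
  assume S: "subring S (ring_of_type_algebra :: 'k ring)"
  show "1 \<in> S \<and> (\<forall>x\<in>S. - x \<in> S) \<and> (\<forall>x\<in>S. \<forall>y\<in>S. x * y \<in> S) \<and> (\<forall>x\<in>S. \<forall>y\<in>S. x + y \<in> S)"
    using subringE(3,5,6,7)[OF S] by simp
next
  interpret cring "ring_of_type_algebra :: 'k ring" by (rule cring_from_type_algebra)
  assume "1 \<in> S \<and> (\<forall>x\<in>S. - x \<in> S) \<and> (\<forall>x\<in>S. \<forall>y\<in>S. x * y \<in> S) \<and> (\<forall>x\<in>S. \<forall>y\<in>S. x + y \<in> S)"
  then show "subring S (ring_of_type_algebra :: 'k ring)" by (intro subringI) auto
qed

context subdomain
begin

text \<open>A common denominator clears a finite sum; conversely z is 1/d times dz. The spanning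
  condition for orders thereby becomes a statement about nonzero multiples of field
  elements.\<close>

lemma span_fractions:
  assumes M: "submod M"
  shows "span_over (fractions D) M = {z. \<exists>d\<in>D. d \<noteq> 0 \<and> d * z \<in> M}"
proof
  show "span_over (fractions D) M \<subseteq> {z. \<exists>d\<in>D. d \<noteq> 0 \<and> d * z \<in> M}"
  proof
    fix z assume "z \<in> span_over (fractions D) M"
    then obtain F c where F: "finite F" "F \<subseteq> M" "\<forall>b\<in>F. c b \<in> fractions D"
      and z: "z = (\<Sum>b\<in>F. c b * b)" unfolding span_over_def by blast
    have "\<exists>d\<in>D. d \<noteq> 0 \<and> d * (\<Sum>b\<in>F. c b * b) \<in> M" using F
    proof induction
      case empty
      then show ?case using one_in submod_zero[OF M] by (intro bexI[of _ 1]) auto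
    next
      case (insert x F)
      then obtain d where d: "d \<in> D" "d \<noteq> 0" "d * (\<Sum>b\<in>F. c b * b) \<in> M" by auto
      obtain a b where ab: "a \<in> D" "b \<in> D" "b \<noteq> 0" "c x = a / b"
        using insert.prems by (auto simp: fractions_def)
      have "(d * b) * (\<Sum>b\<in>insert x F. c b * b) = (d * a) * x + b * (d * (\<Sum>b\<in>F. c b * b))"
        using insert.hyps ab by (simp add: algebra_simps)
      also have "\<dots> \<in> M"
      proof (rule submod_add[OF M])
        show "(d * a) * x \<in> M" using d ab insert.prems mult_in by (intro submod_scale[OF M]) auto
        show "b * (d * (\<Sum>b\<in>F. c b * b)) \<in> M" by (rule submod_scale[OF M ab(2) d(3)])
      qed
      finally show ?case using d ab mult_in by (intro bexI[of _ "d * b"]) auto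
    qed
    then show "z \<in> {z. \<exists>d\<in>D. d \<noteq> 0 \<and> d * z \<in> M}" by (simp add: z)
  qed
next
  show "{z. \<exists>d\<in>D. d \<noteq> 0 \<and> d * z \<in> M} \<subseteq> span_over (fractions D) M"
  proof
    fix z assume "z \<in> {z. \<exists>d\<in>D. d \<noteq> 0 \<and> d * z \<in> M}"
    then obtain d where d: "d \<in> D" "d \<noteq> 0" "d * z \<in> M" by auto
    have "1 / d \<in> fractions D" unfolding fractions_def using d one_in by blast
    moreover have "z = (\<Sum>b\<in>{d * z}. (1 / d) * b)" using d by simp
    ultimately show "z \<in> span_over (fractions D) M"
      unfolding span_over_def using d(3)
      by (intro CollectI exI[of _ "{d * z}"] exI[of _ "\<lambda>_. 1 / d"] conjI) auto
  qed
qed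

text \<open>A span is a submodule, so finite generation already supplies negatives, and 1 comes from
  \<open>D \<subseteq> S\<close>. The spanning condition is restated by
  \<open>span_fractions\<close>.\<close>

lemma is_order_iff:
  "is_order_over D S \<longleftrightarrow> D \<subseteq> S \<and> (\<forall>x\<in>S. \<forall>y\<in>S. x * y \<in> S) \<and> (\<forall>x\<in>S. \<forall>y\<in>S. x + y \<in> S) \<and>
     (\<exists>B. finite B \<and> span_over D B = S) \<and> (\<forall>z. \<exists>d\<in>D. d \<noteq> 0 \<and> d * z \<in> S)"
proof -
  have *: "submod S" if "\<exists>B. finite B \<and> span_over D B = S" using that submod_span by blast
  show ?thesis
  proof (cases "submod S")
    case True
    then have "span_over (fractions D) S = UNIV \<longleftrightarrow> (\<forall>z. \<exists>d\<in>D. d \<noteq> 0 \<and> d * z \<in> S)"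
      "\<forall>x\<in>S. - x \<in> S" using span_fractions[OF True] submod_uminus[OF True] by auto
    then show ?thesis
      unfolding is_order_over_def subring_type_algebra_iff using one_in by auto
  next
    case False
    with * show ?thesis unfolding is_order_over_def by blast
  qed
qed

lemma order_submod: "is_order_over D S \<Longrightarrow> submod S"
  using submod_span unfolding is_order_iff by auto

end

section \<open>A Euclidean ring embedded in the field\<close>

lemma euclidean_principal:
  fixes I :: "'a::euclidean_ring set"
  assumes "0 \<in> I" "\<And>x y. x \<in> I \<Longrightarrow> y \<in> I \<Longrightarrow> x + y \<in> I" "\<And>r x. x \<in> I \<Longrightarrow> r * x \<in> I"
  shows "\<exists>g. I = multiples g"
proof (cases "I = {0}")
  case True
  then have "I = multiples 0" by auto
  then show ?thesis by blast
next
  case False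
  then have "\<exists>x. x \<in> I \<and> x \<noteq> 0" using assms(1) by auto
  then obtain g where g: "g \<in> I" "g \<noteq> 0"
    and least: "\<And>y. y \<in> I \<Longrightarrow> y \<noteq> 0 \<Longrightarrow> euclidean_size g \<le> euclidean_size y"
    using ex_has_least_nat[of "\<lambda>x. x \<in> I \<and> x \<noteq> 0" _ euclidean_size] by metis
  have "g dvd y" if y: "y \<in> I" for y
  proof -
    have "y mod g = y + (- (y div g)) * g" by (simp add: minus_div_mult_eq_mod[symmetric])
    also have "\<dots> \<in> I" using y g by (intro assms)
    finally have "y mod g = 0" using least[of "y mod g"] mod_size_less[OF g(2), of y] by force
    then show ?thesis by auto
  qed
  moreover have "y \<in> I" if "g dvd y" for y
    using that assms(3)[OF g(1)] by (auto simp: dvd_def mult.commute)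
  ultimately have "I = multiples g" by auto
  then show ?thesis by blast
qed

locale euclidean_embedding =
  fixes j :: "'a::euclidean_ring \<Rightarrow> 'k::field"
  assumes j_hom: "j \<in> ring_hom ring_of_type_algebra ring_of_type_algebra" and j_inj: "inj j"
begin

lemma j_add: "j (x + y) = j x + j y" and j_mult: "j (x * y) = j x * j y" and j_one: "j 1 = 1"
  using ring_hom_add[OF j_hom, of x y] ring_hom_mult[OF j_hom, of x y] ring_hom_one[OF j_hom]
  by simp_all

lemma j_zero: "j 0 = 0"
  using j_add[of 0 0] unfolding add_0_left by (metis add_cancel_left_left)

lemma j_uminus: "j (- x) = - j x"
  using j_add[of x "- x"] by (simp add: j_zero eq_neg_iff_add_eq_0 add.commute)

lemma j_diff: "j (x - y) = j x - j y"
  using j_add[of x "- y"] by (simp add: j_uminus)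

lemma j_eq_zero_iff: "j x = 0 \<longleftrightarrow> x = 0"
  using j_inj j_zero by (metis injD)

text \<open>Size and division are carried from A to its copy along \<open>j\<close>; injectivity
  makes the size of an image equal to that of its preimage.\<close>

sublocale euclidean_subdomain "range j" "\<lambda>x. euclidean_size (inv_into UNIV j x)"
proof
  show "0 \<in> range j" "1 \<in> range j" using j_zero j_one by (metis rangeI)+
  show "x + y \<in> range j" "x * y \<in> range j" if "x \<in> range j" "y \<in> range j" for x y
    using that by (auto simp flip: j_add j_mult)
  show "- x \<in> range j" if "x \<in> range j" for x
    using that by (auto simp flip: j_uminus)
next
  fix x y assume "x \<in> range j" "y \<in> range j" "y \<noteq> 0"
  then obtain a b where ab: "x = j a" "y = j b" "b \<noteq> 0" using j_zero by (metis imageE)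
  have "x - j (a div b) * y = j (a mod b)"
    by (simp add: ab minus_div_mult_eq_mod flip: j_mult j_diff)
  then show "\<exists>q\<in>range j. x - q * y = 0 \<or>
      euclidean_size (inv_into UNIV j (x - q * y)) < euclidean_size (inv_into UNIV j y)"
    using mod_size_less[OF ab(3), of a] j_inj ab by (intro bexI[of _ "j (a div b)"]) auto
qed

lemma order_has_basis:
  assumes "is_order_over (range j) S"
  obtains E where "finite E" "indep E" "span_over (range j) E = S"
  using assms finite_span_has_basis unfolding is_order_iff is_basis_iff by metis

end


context euclidean_subdomain
begin

text \<open>Stacked bases for \<open>D \<subseteq> S\<close> give a basis vector \<open>x\<close> with \<open>e x = 1\<close>; \<open>x\<^sup>2 \<in> S\<close> is then
  a \<open>D\<close>-multiple of \<open>x\<close> by independence, so \<open>x\<close> is a unit of \<open>D\<close> and may be replaced by \<open>1\<close>.\<close>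

lemma order_has_basis_with_one:
  assumes S: "is_order_over D S"
  shows "\<exists>B. 1 \<in> B \<and> is_basis_over D S B"
proof -
  obtain B where B: "finite B" "indep B" "span_over D B = S"
    using S finite_span_has_basis unfolding is_order_iff is_basis_iff by metis
  have sub: "D \<subseteq> S" and mult: "\<And>x y. x \<in> S \<Longrightarrow> y \<in> S \<Longrightarrow> x * y \<in> S" using S by (auto simp: is_order_iff)
  obtain E d Y where E: "finite E" "indep E" "span_over D E = S" and d: "\<forall>x\<in>E. d x \<in> D"
    and D_eq: "D = {\<Sum>x\<in>E. c x * (d x * x) | c. \<forall>x\<in>E. c x \<in> D}"
    and "finite Y" "indep Y" "span_over D Y = D"
    by (rule stacked_bases[OF B submod_self sub])
  have dD: "d x * x \<in> D" if "x \<in> E" for x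
  proof -
    have "(\<Sum>y\<in>E. (if y = x then 1 else 0) * (d y * y)) = (\<Sum>y\<in>E. if y = x then d x * x else 0)"
      by (intro sum.cong) auto
    also have "\<dots> = d x * x" using that E(1) by simp
    finally show ?thesis
      by (subst D_eq, intro CollectI exI[of _ "\<lambda>y. if y = x then 1 else 0"])
        (simp add: zero_in one_in)
  qed
  have "1 \<in> {\<Sum>x\<in>E. c x * (d x * x) | c. \<forall>x\<in>E. c x \<in> D}"
    by (subst D_eq[symmetric]) (rule one_in)
  then obtain c where c: "\<forall>x\<in>E. c x \<in> D" "1 = (\<Sum>x\<in>E. c x * (d x * x))" by blast
  have "\<not> (\<forall>x\<in>E. d x = 0)"
  proof
    assume "\<forall>x\<in>E. d x = 0"
    then have "(\<Sum>x\<in>E. c x * (d x * x)) = 0" by (intro sum.neutral) auto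
    with c(2) show False by simp
  qed
  then obtain x where x: "x \<in> E" "d x \<noteq> 0" by blast
  have "E = insert x (E - {x})" using x by auto
  then have "indep (E - {x})" and coord: "\<And>a. a \<in> D \<Longrightarrow> a * x \<in> span_over D (E - {x}) \<Longrightarrow> a = 0"
    using indep_insert[of "E - {x}" x] E x by auto
  have S_eq: "S = {a * x + w | a w. a \<in> D \<and> w \<in> span_over D (E - {x})}"
    using span_insert[of x "E - {x}"] E x by (simp add: insert_absorb)
  have x_nz: "x \<noteq> 0"
    using coord[OF one_in] submod_zero[OF submod_span] by auto
  \<comment> \<open>D has rank one: both \<open>d x * x\<close> and \<open>d y * y\<close> lie in D,
    so their product is a D-multiple of \<open>x\<close> and of \<open>y\<close> at once.
    Independence makes the coefficient at \<open>x\<close> vanish, and \<open>d x\<close> is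
    nonzero.\<close>
  have d0: "d y = 0" if y: "y \<in> E" "y \<noteq> x" for y
  proof -
    have "y \<noteq> 0"
    proof
      assume "y = 0"
      then have "(\<Sum>z\<in>E. (if z = y then 1 else 0) * z) = 0"
        by (intro sum.neutral) auto
      moreover have "\<forall>z\<in>E. (if z = y then 1 else 0) \<in> D" by (simp add: zero_in one_in)
      ultimately show False
        using indepD[OF E(2), of "\<lambda>z. if z = y then 1 else 0" y] y(1) by simp
    qed
    have "d y * y * d x * x = (d x * x * d y) * y" by simp
    also have "\<dots> \<in> span_over D (E - {x})"
      by (rule submod_scale[OF submod_span mult_in[OF dD[OF x(1)]]])
        (use d y span_superset[of "E - {x}"] in auto)
    finally have "d y * y * d x = 0"
      using coord[of "d y * y * d x"] dD[OF y(1)] d x mult_in by auto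
    with x \<open>y \<noteq> 0\<close> show ?thesis by simp
  qed
  have "(\<Sum>y\<in>E. c y * (d y * y)) = c x * (d x * x)"
    using d0 E(1) x by (subst sum.remove[OF E(1) x(1)]) (simp add: sum.neutral)
  then have e1: "(c x * d x) * x = 1" using c(2) by (simp add: mult.assoc)
  define e where "e = c x * d x"
  have e: "e \<in> D" "e * x = 1" using c d x e1 mult_in by (auto simp: e_def)
  have "x \<in> S" using span_superset[of E] E x by auto
  then have "x * x \<in> S" using mult by blast
  then obtain a w where aw: "a \<in> D" "w \<in> span_over D (E - {x})" "x * x = a * x + w"
    unfolding S_eq by blast
  \<comment> \<open>The relation \<open>x * x = a * x + w\<close> is multiplied by \<open>e\<close>,
    and \<open>e * x = 1\<close> lowers the square. Independence then yields
    \<open>e * a = 1 = e * x\<close>, so \<open>x = a\<close>.\<close>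
  have "(1 - e * a) * x = e * w"
  proof -
    have "x = e * (x * x)" using e(2) by (simp only: mult.assoc[symmetric] mult_1_left)
    also have "\<dots> = (e * a) * x + e * w" unfolding aw(3) by (simp only: distrib_left mult.assoc)
    finally show ?thesis by (simp add: left_diff_distrib diff_eq_eq add.commute)
  qed
  also have "\<dots> \<in> span_over D (E - {x})" using e(1) aw(2) by (rule submod_scale[OF submod_span])
  finally have "1 - e * a = 0" using coord[of "1 - e * a"] e aw one_in mult_in diff_in by auto
  then have "e * a = e * x" using e(2) by simp
  moreover have "e \<noteq> 0" using e(2) by auto
  ultimately have xD: "x \<in> D" using aw(1) by simp
  have "indep (insert 1 (E - {x}))"
  proof -
    have zero: "b = 0" if "b \<in> D" "b * 1 \<in> span_over D (E - {x})" for b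
    proof -
      have eq: "(b * e) * x = b * 1" using e(2) by (simp only: mult.assoc)
      have "b * e = 0"
      proof (rule coord)
        show "b * e \<in> D" using that(1) e(1) by (rule mult_in)
        show "b * e * x \<in> span_over D (E - {x})" unfolding eq by (rule that(2))
      qed
      then show ?thesis using e by auto
    qed
    then have "1 \<notin> E - {x}" using one_in span_superset[of "E - {x}"] zero_neq_one
      by (metis mult_1_left subsetD)
    with zero \<open>indep (E - {x})\<close> E(1) show ?thesis by (simp add: indep_insert)
  qed
  moreover have "span_over D (insert 1 (E - {x})) = S"
  proof -
    have "{a * 1 + w | a w. a \<in> D \<and> w \<in> span_over D (E - {x})} = S"
    proof (intro Set.set_eqI iffI)
      fix z assume "z \<in> {a * 1 + w | a w. a \<in> D \<and> w \<in> span_over D (E - {x})}"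
      then obtain b v where "b \<in> D" "v \<in> span_over D (E - {x})" "z = (b * e) * x + v"
        using e by (auto simp: mult.assoc)
      then show "z \<in> S" unfolding S_eq using e mult_in by blast
    next
      fix z assume "z \<in> S"
      then obtain b v where "b \<in> D" "v \<in> span_over D (E - {x})" "z = (b * x) * 1 + v"
        unfolding S_eq by auto
      then show "z \<in> {a * 1 + w | a w. a \<in> D \<and> w \<in> span_over D (E - {x})}"
        using xD mult_in by blast
    qed
    then show ?thesis by (simp add: span_insert)
  qed
  ultimately show ?thesis using E(1) unfolding is_basis_iff by (intro exI[of _ "insert 1 (E - {x})"]) auto
qed

end

section \<open>Localisation at a prime with generator \<pi>\<close>

locale localisation = euclidean_embedding j for j :: "'a::euclidean_ring \<Rightarrow> 'k::field" +
  fixes \<pp> :: "'a set" and \<pi> :: 'a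
  assumes prime: "primeideal \<pp> ring_of_type_algebra" and p_eq: "\<pp> = multiples \<pi>"
    and \<pi>_nz: "\<pi> \<noteq> 0"
begin

lemma p_zero: "0 \<in> \<pp>" by (simp add: p_eq)

lemma p_one: "1 \<notin> \<pp>"
proof -
  interpret primeideal \<pp> "ring_of_type_algebra :: 'a ring" by (rule prime)
  show ?thesis using one_imp_carrier I_notcarr by auto
qed

lemma p_mult: "s \<notin> \<pp> \<Longrightarrow> t \<notin> \<pp> \<Longrightarrow> s * t \<notin> \<pp>"
proof -
  interpret primeideal \<pp> "ring_of_type_algebra :: 'a ring" by (rule prime)
  show "s \<notin> \<pp> \<Longrightarrow> t \<notin> \<pp> \<Longrightarrow> s * t \<notin> \<pp>" using I_prime[of s t] by auto
qed

lemma j_nonzero: "s \<notin> \<pp> \<Longrightarrow> j s \<noteq> 0"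
  using p_zero by (auto simp: j_eq_zero_iff)

text \<open>For a single \<pi>, let g generate the ideal (s, \<pi>) and write \<pi> = g h. As g
  divides s it is not in \<pp>, so primality puts h into \<pp>; then h is a multiple of \<pi> and g
  is a unit. Multiplying such identities raises the exponent.\<close>

lemma coprime_power:
  assumes s: "s \<notin> \<pp>"
  shows "\<exists>u v. u * s + v * \<pi> ^ m = 1"
proof (induction m)
  case 0
  have "0 * s + 1 * \<pi> ^ 0 = 1" by simp
  then show ?case by blast
next
  case (Suc m)
  let ?I = "{u * s + v * \<pi> | u v. True}"
  have "\<exists>g. ?I = multiples g"
  proof (rule euclidean_principal)
    show "0 \<in> ?I" by (intro CollectI exI[of _ 0]) simp
    show "x + y \<in> ?I" if "x \<in> ?I" "y \<in> ?I" for x y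
    proof -
      from that obtain u v u' v' where "x = u * s + v * \<pi>" "y = u' * s + v' * \<pi>" by blast
      then have "x + y = (u + u') * s + (v + v') * \<pi>" by (simp add: algebra_simps)
      then show ?thesis by blast
    qed
    show "r * x \<in> ?I" if "x \<in> ?I" for r x
    proof -
      from that obtain u v where "x = u * s + v * \<pi>" by blast
      then have "r * x = (r * u) * s + (r * v) * \<pi>" by (simp add: algebra_simps)
      then show ?thesis by blast
    qed
  qed
  then obtain g where I: "?I = multiples g" ..
  have "1 * s + 0 * \<pi> \<in> ?I" "0 * s + 1 * \<pi> \<in> ?I" by blast+
  then have "g dvd s" "g dvd \<pi>" unfolding I by simp_all
  then obtain h where h: "\<pi> = g * h" by (auto simp: dvd_def)
  have "g \<notin> \<pp>" using s \<open>g dvd s\<close> by (auto simp: p_eq intro: dvd_trans)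
  then have "h \<in> \<pp>" using p_mult[of g h] h by (auto simp: p_eq)
  then obtain w where "h = \<pi> * w" by (auto simp: p_eq dvd_def)
  with h \<pi>_nz have "g * w = 1" by (metis mult.assoc mult.commute mult.right_neutral mult_left_cancel)
  then have "g dvd 1" by (metis dvd_triv_left)
  then have "1 \<in> ?I" unfolding I by simp
  then obtain u v where uv: "1 = u * s + v * \<pi>" by blast
  obtain u' v' where uv': "u' * s + v' * \<pi> ^ m = 1" using Suc by blast
  have "1 = (u * s + v * \<pi>) * (u' * s + v' * \<pi> ^ m)" using uv uv' by simp
  also have "\<dots> = (u * (u' * s + v' * \<pi> ^ m) + v * \<pi> * u') * s + (v * v') * \<pi> ^ Suc m"
    by (simp add: algebra_simps)
  finally show ?case by metis
qed

text \<open>Splitting off a factor \<pi> strictly lowers the Euclidean size, since \<pi> is not a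
  unit. Hence the \<pi>-adic valuation is finite.\<close>

lemma prime_power_decomposition:
  assumes "d \<noteq> 0"
  shows "\<exists>n u. d = \<pi> ^ n * u \<and> u \<notin> \<pp>"
  using assms
proof (induction "euclidean_size d" arbitrary: d rule: less_induct)
  case less
  show ?case
  proof (cases "d \<in> \<pp>")
    case False
    then show ?thesis by (intro exI[of _ 0] exI[of _ d]) simp
  next
    case True
    then obtain d' where d': "d = \<pi> * d'" by (auto simp: p_eq dvd_def)
    have "\<not> d dvd d'"
    proof
      assume "d dvd d'"
      then obtain k where "d' = \<pi> * d' * k" by (auto simp: d' dvd_def)
      with less.prems have "\<pi> * k = 1" by (auto simp: d' mult.assoc mult.left_commute)
      then show False using p_one by (auto simp: p_eq dvd_def)
    qed
    then have "euclidean_size d' < euclidean_size d"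
      using less.prems by (intro dvd_proper_imp_size_less) (auto simp: d')
    moreover have "d' \<noteq> 0" using less.prems d' by auto
    ultimately obtain n u where "d' = \<pi> ^ n * u" "u \<notin> \<pp>" using less.hyps by blast
    then show ?thesis by (intro exI[of _ "Suc n"] exI[of _ u]) (simp add: d' mult.assoc)
  qed
qed

text \<open>The factor of \<open>t\<close> outside \<pp> divides a power of \<pi> and is coprime to
  it, hence is a unit.\<close>

lemma multiples_dvd_prime_power:
  assumes "t dvd \<pi> ^ m"
  shows "\<exists>k. multiples t = multiples (\<pi> ^ k)"
proof -
  have "t \<noteq> 0" using assms \<pi>_nz by auto
  then obtain k u where t: "t = \<pi> ^ k * u" "u \<notin> \<pp>" using prime_power_decomposition by blast
  obtain a b where "a * u + b * \<pi> ^ m = 1" using coprime_power[OF t(2)] by blast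
  moreover have "u dvd \<pi> ^ m" using assms t(1) by (auto intro: dvd_trans)
  ultimately have "u dvd 1" by (metis dvd_add dvd_mult dvd_refl)
  then have "multiples t = multiples (\<pi> ^ k)" by (auto simp: t(1) mult_unit_dvd_iff)
  then show ?thesis by blast
qed

abbreviation "Dp \<equiv> localised_ring j \<pp>"

lemma add_j_fractions: "y / j s + z / j t = (j t * y + j s * z) / j (s * t)"
  if "s \<notin> \<pp>" "t \<notin> \<pp>"
  using j_nonzero that by (simp add: j_mult divide_simps)

lemma localised_ringI: "s \<notin> \<pp> \<Longrightarrow> j a / j s \<in> Dp"
  unfolding localised_ring_def by blast

lemma range_subset_localised: "range j \<subseteq> Dp"
  using localised_ringI[OF p_one] by (auto simp: j_one)

sublocale loc: subdomain Dp
proof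
  show "0 \<in> Dp" "1 \<in> Dp" using range_subset_localised zero_in one_in by auto
next
  fix x y assume "x \<in> Dp" "y \<in> Dp"
  then obtain a s b t where *: "x = j a / j s" "s \<notin> \<pp>" "y = j b / j t" "t \<notin> \<pp>"
    unfolding localised_ring_def by blast
  then have "x + y = j (t * a + s * b) / j (s * t)" "x * y = j (a * b) / j (s * t)"
    by (simp_all add: add_j_fractions j_add j_mult)
  then show "x + y \<in> Dp" "x * y \<in> Dp" using localised_ringI[OF p_mult[OF *(2,4)]] by simp_all
next
  fix x assume "x \<in> Dp"
  then obtain a s where "x = j a / j s" "s \<notin> \<pp>" unfolding localised_ring_def by blast
  then show "- x \<in> Dp" using localised_ringI[of s "- a"] by (simp add: j_uminus)
qed

text \<open>A basis containing 1 exists, so \<open>localised_order_eq\<close> replaces the chosen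
  basis by a known one. A common denominator then turns its span over \<open>Dp\<close> into single
  fractions.\<close>

lemma localised_order_iff:
  assumes S: "is_order_over (range j) S"
  shows "localised_order j \<pp> S = {y / j s | y s. y \<in> S \<and> s \<notin> \<pp>}"
    and "\<exists>B. finite B \<and> localised_order j \<pp> S = span_over Dp B"
proof -
  obtain B where B: "1 \<in> B" "is_basis_over (range j) S B"
    using order_has_basis_with_one[OF S] by blast
  have eq: "localised_order j \<pp> S = span_over Dp B"
    by (rule localised_order_eq[OF j_hom j_inj prime B])
  have fin: "finite B" and S_eq: "span_over (range j) B = S" using B(2) by (auto simp: is_basis_iff)
  note sub = order_submod[OF S]
  show "\<exists>B. finite B \<and> localised_order j \<pp> S = span_over Dp B" using eq fin by blast
  have "span_over Dp B \<subseteq> {y / j s | y s. y \<in> S \<and> s \<notin> \<pp>}" (is "_ \<subseteq> ?L")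
  proof (rule loc.span_least)
    show "loc.submod ?L" unfolding loc.submod_def
    proof (intro conjI ballI)
      show "0 \<in> ?L" using submod_zero[OF sub] p_one by force
    next
      fix x y assume "x \<in> ?L" "y \<in> ?L"
      then obtain a s b t where *: "x = a / j s" "s \<notin> \<pp>" "y = b / j t" "t \<notin> \<pp>" "a \<in> S" "b \<in> S"
        by blast
      then have "x + y = (j t * a + j s * b) / j (s * t)" by (simp add: add_j_fractions)
      moreover have "j t * a + j s * b \<in> S" using * sub by (auto intro: submod_add submod_scale)
      ultimately show "x + y \<in> ?L" using p_mult * by blast
    next
      fix x y assume "x \<in> Dp" "y \<in> ?L"
      then obtain a s b t where *: "x = j a / j s" "s \<notin> \<pp>" "y = b / j t" "t \<notin> \<pp>" "b \<in> S"
        unfolding localised_ring_def by blast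
      then have "x * y = (j a * b) / j (s * t)" by (simp add: j_mult)
      moreover have "j a * b \<in> S" using * sub by (auto intro: submod_scale)
      ultimately show "x * y \<in> ?L" using p_mult * by blast
    qed
    show "B \<subseteq> ?L"
    proof
      fix b assume "b \<in> B"
      then have "b \<in> S" using span_superset[of B] S_eq by auto
      moreover have "b = b / j 1" by (simp add: j_one)
      ultimately show "b \<in> ?L" using p_one by blast
    qed
  qed
  moreover have "?L \<subseteq> span_over Dp B"
  proof
    fix x assume "x \<in> ?L"
    then obtain y s where *: "x = y / j s" "y \<in> S" "s \<notin> \<pp>" by blast
    have "S \<subseteq> span_over Dp B" unfolding S_eq[symmetric]
      using range_subset_localised by (force simp: span_over_def)
    moreover have "x = (j 1 / j s) * y" using * by (simp add: j_one)
    ultimately show "x \<in> span_over Dp B"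
      using * localised_ringI loc.submod_scale[OF loc.submod_span] by blast
  qed
  ultimately show "localised_order j \<pp> S = ?L" unfolding eq by blast
qed

lemma localised_order_is_order:
  assumes S: "is_order_over (range j) S"
  shows "is_order_over Dp (localised_order j \<pp> S)"
proof -
  note L = localised_order_iff(1)[OF S]
  have SL: "S \<subseteq> localised_order j \<pp> S"
  proof
    fix x assume "x \<in> S"
    moreover have "x = x / j 1" by (simp add: j_one)
    ultimately show "x \<in> localised_order j \<pp> S" unfolding L using p_one by blast
  qed
  have range: "range j \<subseteq> S" and mult: "\<And>x y. x \<in> S \<Longrightarrow> y \<in> S \<Longrightarrow> x * y \<in> S"
    and frac: "\<And>z. \<exists>d\<in>range j. d \<noteq> 0 \<and> d * z \<in> S"
    using S unfolding is_order_iff by auto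
  have fg: "\<exists>B. finite B \<and> span_over Dp B = localised_order j \<pp> S"
    using localised_order_iff(2)[OF S] by metis
  then have sub: "loc.submod (localised_order j \<pp> S)" using loc.submod_span by metis
  show ?thesis unfolding loc.is_order_iff
  proof (intro conjI ballI allI fg)
    show "Dp \<subseteq> localised_order j \<pp> S"
      unfolding L localised_ring_def using range by blast
    show "x + y \<in> localised_order j \<pp> S"
      if "x \<in> localised_order j \<pp> S" "y \<in> localised_order j \<pp> S" for x y
      using loc.submod_add[OF sub that] .
  next
    fix x y assume "x \<in> localised_order j \<pp> S" "y \<in> localised_order j \<pp> S"
    then obtain a s b t where *: "x = a / j s" "s \<notin> \<pp>" "y = b / j t" "t \<notin> \<pp>" "a \<in> S" "b \<in> S"
      unfolding L by blast
    then have "x * y = (a * b) / j (s * t)" by (simp add: j_mult)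
    then show "x * y \<in> localised_order j \<pp> S"
      unfolding L using p_mult * mult by blast
  next
    fix z
    obtain d where "d \<in> range j" "d \<noteq> 0" "d * z \<in> S" using frac by blast
    then show "\<exists>d\<in>Dp. d \<noteq> 0 \<and> d * z \<in> localised_order j \<pp> S"
      using range_subset_localised SL by blast
  qed
qed

end

section \<open>The bijection for an arbitrary order\<close>

context localisation
begin

abbreviation order_module :: "'k set \<Rightarrow> ('a, 'k) module" where
  "order_module S \<equiv> \<lparr>carrier = S, monoid.mult = (*), one = 1, zero = 0, add = (+),
     module.smult = (\<lambda>a x. j a * x)\<rparr>"

lemma quotient_setup_order: "submod R \<Longrightarrow> quotient_setup (order_module S) R"
  by unfold_locales
    (auto simp: distrib_left j_zero intro: submod_zero submod_add submod_uminus submod_scale)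

lemma pow_p: "\<pp> [^]\<^bsub>ideals_set ring_of_type_algebra\<^esub> (n::nat) = multiples (\<pi> ^ n)"
  by (simp add: p_eq pow_multiples)

text \<open>The index ideal annihilates S/R, and here it contains a power of \<pi>. This is the form
  in which the index condition enters the injectivity argument.\<close>

lemma overorder_annihilated:
  assumes "submod R" and S: "S \<in> overorders_at j \<pp> R"
  shows "\<exists>n. \<forall>x\<in>S. j (\<pi> ^ n) * x \<in> R"
proof -
  interpret quotient_setup "order_module S" R using assms(1) by (rule quotient_setup_order)
  from S have "submod S" by (auto simp: overorders_at_def intro: order_submod)
  from S obtain n where "has_index_ideal ring_of_type_algebra (order_module S) R (multiples (\<pi> ^ n))"
    unfolding overorders_at_def pow_p by blast
  then have "j (\<pi> ^ n) * x \<in> R" if "x \<in> S" for x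
    using index_ideal_annihilates[of "multiples (\<pi> ^ n)" "\<pi> ^ n" x] that \<open>submod S\<close>
    by (simp add: submod_scale)
  then show ?thesis by blast
qed

text \<open>Stacked bases identify \<open>S/R\<close> with a sum of modules \<open>A/(t\<^sub>i)\<close>; each \<open>t\<^sub>i\<close> divides \<open>\<pi>\<^sup>m\<close>, so
  the order ideal is generated by a power of \<open>\<pi>\<close>.\<close>

lemma annihilated_overorder:
  assumes "submod R" and S: "is_order_over (range j) S" and "R \<subseteq> S"
    and m: "\<And>x. x \<in> S \<Longrightarrow> j (\<pi> ^ m) * x \<in> R"
  shows "S \<in> overorders_at j \<pp> R"
proof -
  interpret quotient_setup "order_module S" R using assms(1) by (rule quotient_setup_order)
  have subS: "submod S" using S by (rule order_submod)
  obtain B where B: "finite B" "indep B" "span_over (range j) B = S"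
    using order_has_basis[OF S] .
  obtain E d Y where E: "finite E" "indep E" "span_over (range j) E = S"
    and d: "\<forall>x\<in>E. d x \<in> range j"
    and R: "R = {\<Sum>x\<in>E. c x * (d x * x) | c. \<forall>x\<in>E. c x \<in> range j}"
    and "finite Y" "indep Y" "span_over (range j) Y = R"
    by (rule stacked_bases[OF B assms(1,3)])
  from d have "\<forall>x\<in>E. \<exists>t. d x = j t" by blast
  then obtain t where t: "\<And>x. x \<in> E \<Longrightarrow> d x = j (t x)" by metis
  have coords: "\<exists>k. x = (\<Sum>b\<in>E. j (k b) * b)" if "x \<in> S" for x
  proof -
    have "x \<in> span_over (range j) E" using that E(3) by simp
    then obtain c where c: "\<forall>b\<in>E. c b \<in> range j" "x = (\<Sum>b\<in>E. c b * b)"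
      using E(1) by (rule span_finiteE)
    then have "\<forall>b\<in>E. \<exists>a. c b = j a" by blast
    then obtain k where "\<And>b. b \<in> E \<Longrightarrow> c b = j (k b)" by metis
    with c(2) have "x = (\<Sum>b\<in>E. j (k b) * b)" by simp
    then show ?thesis by blast
  qed
  \<comment> \<open>\<open>K x b\<close> is a coordinate in A itself, not in its copy, so that
    membership in \<open>R\<close> can be expressed by divisibility by \<open>t b\<close>.\<close>
  then obtain K where K: "\<And>x. x \<in> S \<Longrightarrow> x = (\<Sum>b\<in>E. j (K x b) * b)" by metis
  have in_S: "(\<Sum>b\<in>E. j (k b) * b) \<in> S" for k
    unfolding E(3)[symmetric] by (rule sum_in_span) auto
  have K_unique: "K x b = k b" if "x = (\<Sum>b\<in>E. j (k b) * b)" "b \<in> E" for x k b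
  proof -
    have "x \<in> S" using in_S that by simp
    then have "j (K x b) = j (k b)"
      using K that by (intro indep_coords_eq[OF E(2), of "\<lambda>b. j (K x b)" "\<lambda>b. j (k b)" b]) auto
    then show ?thesis using j_inj by (auto dest: injD)
  qed
  have K_add: "K (x + y) b = K x b + K y b" if "x \<in> S" "y \<in> S" "b \<in> E" for x y b
  proof (rule K_unique)
    show "x + y = (\<Sum>b\<in>E. j (K x b + K y b) * b)"
      using K[OF that(1)] K[OF that(2)] by (simp add: j_add distrib_right sum.distrib)
  qed fact
  have K_smult: "K (j r * x) b = r * K x b" if "x \<in> S" "b \<in> E" for r x b
  proof (rule K_unique)
    have "j r * x = j r * (\<Sum>b\<in>E. j (K x b) * b)" using K[OF that(1)] by simp
    then show "j r * x = (\<Sum>b\<in>E. j (r * K x b) * b)"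
      by (simp add: j_mult sum_distrib_left mult.assoc)
  qed fact
  have mem_R: "x \<in> R \<longleftrightarrow> (\<forall>b\<in>E. t b dvd K x b)" if x: "x \<in> S" for x
  proof
    assume "x \<in> R"
    then obtain c where c: "\<forall>b\<in>E. c b \<in> range j" "x = (\<Sum>b\<in>E. c b * (d b * b))"
      unfolding R by blast
    then have "\<forall>b\<in>E. \<exists>a. c b = j a" by blast
    then obtain k where "\<And>b. b \<in> E \<Longrightarrow> c b = j (k b)" by metis
    then have "x = (\<Sum>b\<in>E. j (k b * t b) * b)" using c(2) t by (simp add: j_mult mult.assoc)
    then have "K x b = k b * t b" if "b \<in> E" for b
      using K_unique[of x "\<lambda>b. k b * t b" b] that by blast
    then show "\<forall>b\<in>E. t b dvd K x b" by simp
  next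
    assume "\<forall>b\<in>E. t b dvd K x b"
    then have "\<forall>b\<in>E. \<exists>q. K x b = t b * q" by (auto simp: dvd_def)
    then obtain q where q: "\<And>b. b \<in> E \<Longrightarrow> K x b = t b * q b" by metis
    have "x = (\<Sum>b\<in>E. j (K x b) * b)" by (rule K[OF x])
    also have "\<dots> = (\<Sum>b\<in>E. j (q b) * (d b * b))"
      by (intro sum.cong refl) (simp add: q t j_mult)
    finally show "x \<in> R" unfolding R by (intro CollectI exI[of _ "\<lambda>b. j (q b)"]) simp
  qed
  \<comment> \<open>The vector \<open>j (\<pi> ^ m) * b\<close> lies in \<open>R\<close>, and its
    coordinate at \<open>b\<close> is \<open>\<pi> ^ m\<close>.\<close>
  have t_dvd: "t b dvd \<pi> ^ m" if b: "b \<in> E" for b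
  proof -
    have "(\<Sum>c\<in>E. j (if c = b then \<pi> ^ m else 0) * c) = (\<Sum>c\<in>E. if c = b then j (\<pi> ^ m) * b else 0)"
      by (intro sum.cong) (auto simp: j_zero)
    also have "\<dots> = j (\<pi> ^ m) * b" using b E(1) by simp
    finally have "K (j (\<pi> ^ m) * b) b = (if b = b then \<pi> ^ m else 0)"
      using b by (intro K_unique[of _ "\<lambda>c. if c = b then \<pi> ^ m else 0"]) simp_all
    moreover have "b \<in> S" using b span_superset[of E] E by auto
    ultimately show ?thesis
      using mem_R[of "j (\<pi> ^ m) * b"] m[of b] submod_scale[OF subS] b by auto
  qed
  \<comment> \<open>\<open>has_order_ideal\<close> indexes its summands by an initial segment of the
    naturals, so the basis is enumerated.\<close>
  obtain e where e: "bij_betw e {..<card E} E"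
    using ex_bij_betw_nat_finite[OF E(1)] by (auto simp: atLeast0LessThan)
  define n where "n = card E"
  have eE: "e i \<in> E" if "i < n" for i using e that by (auto simp: n_def bij_betw_def)
  have E_eq: "e ` {..<n} = E" using e by (simp add: n_def bij_betw_def)
  have all_E: "(\<forall>b\<in>E. P b) \<longleftrightarrow> (\<forall>i<n. P (e i))" for P
    unfolding E_eq[symmetric] by auto
  have "has_index_ideal ring_of_type_algebra (order_module S) R
      (finprod (ideals_set ring_of_type_algebra) (\<lambda>i. multiples (t (e i))) {..<n})"
  proof (rule has_index_idealI[where \<kappa> = "\<lambda>x i. K x (e i)"])
    fix i assume "i < n"
    then have "t (e i) dvd \<pi> ^ m" by (intro t_dvd eE)
    then have "t (e i) \<noteq> 0" using \<pi>_nz by auto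
    moreover have "t (e i) \<in> multiples (t (e i))" by simp
    ultimately show "multiples (t (e i)) \<noteq> {0}" by blast
  next
    fix k :: "nat \<Rightarrow> 'a"
    define k' where "k' b = k (the_inv_into {..<n} e b)" for b
    have "K (\<Sum>b\<in>E. j (k' b) * b) (e i) = k i" if "i < n" for i
      using K_unique[OF refl eE[OF that], of k'] that e
      by (simp add: k'_def n_def bij_betw_def the_inv_into_f_f)
    then show "\<exists>x\<in>carrier (order_module S). \<forall>i<n. K x (e i) = k i"
      using in_S[of k'] by auto
  qed (use subS assms(3) eE K_add K_smult mem_R all_E
       in \<open>auto simp: ideal_multiples intro: submod_add submod_uminus submod_scale\<close>)
  moreover have "\<exists>k. finprod (ideals_set ring_of_type_algebra) (\<lambda>i. multiples (t (e i))) {..<n} =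
      multiples (\<pi> ^ k)"
  proof -
    have "(\<Prod>i<n. t (e i)) dvd (\<Prod>i<n. \<pi> ^ m)" using t_dvd eE by (intro prod_dvd_prod) auto
    also have "(\<Prod>i<n. \<pi> ^ m) = \<pi> ^ (m * n)" by (simp add: power_mult)
    finally show ?thesis unfolding finprod_multiples by (rule multiples_dvd_prime_power)
  qed
  ultimately show ?thesis using S assms(3) unfolding overorders_at_def pow_p by auto
qed

theorem bij_betw_localised_order:
  assumes R: "is_order_over (range j) R"
  shows "bij_betw (localised_order j \<pp>) (overorders_at j \<pp> R)
    (overorders_over Dp (localised_order j \<pp> R))"
proof -
  note subR = order_submod[OF R]
  have order: "is_order_over (range j) S" "R \<subseteq> S" if "S \<in> overorders_at j \<pp> R" for S
    using that by (auto simp: overorders_at_def)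
  \<comment> \<open>The Bezout identity is applied to \<open>S'\<close> for injectivity, and to
    \<open>R\<close> to bound the exponents in the preimage of \<open>T\<close>.\<close>
  have cancel: "x \<in> M" if M: "submod M" and "s \<notin> \<pp>" "j s * x \<in> M" "j (\<pi> ^ n) * x \<in> M" for M s n x
  proof -
    obtain u v where uv: "u * s + v * \<pi> ^ n = 1" using coprime_power[OF \<open>s \<notin> \<pp>\<close>] by blast
    have "x = j (u * s + v * \<pi> ^ n) * x" by (simp add: uv j_one)
    also have "\<dots> = j u * (j s * x) + j v * (j (\<pi> ^ n) * x)" by (simp add: j_add j_mult algebra_simps)
    also have "\<dots> \<in> M"
      by (intro submod_add[OF M] submod_scale[OF M rangeI that(3)] submod_scale[OF M rangeI that(4)])
    finally show ?thesis .
  qed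
  have image: "localised_order j \<pp> S \<in> overorders_over Dp (localised_order j \<pp> R)"
    if "S \<in> overorders_at j \<pp> R" for S
    using order[OF that] localised_order_is_order R
    by (auto simp: overorders_over_def localised_order_iff(1))
  have "S \<subseteq> S'" if S: "S \<in> overorders_at j \<pp> R" and S': "S' \<in> overorders_at j \<pp> R"
    and eq: "localised_order j \<pp> S = localised_order j \<pp> S'" for S S'
  proof
    fix x assume x: "x \<in> S"
    obtain n where n: "\<forall>x\<in>S. j (\<pi> ^ n) * x \<in> R" using overorder_annihilated[OF subR S] by blast
    have "x = x / j 1" by (simp add: j_one)
    then have "x \<in> localised_order j \<pp> S"
      unfolding localised_order_iff(1)[OF order(1)[OF S]] using x p_one by blast
    then obtain y s where ys: "x = y / j s" "y \<in> S'" "s \<notin> \<pp>"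
      unfolding eq localised_order_iff(1)[OF order(1)[OF S']] by blast
    show "x \<in> S'"
    proof (rule cancel)
      show "submod S'" using order_submod order(1)[OF S'] .
      show "s \<notin> \<pp>" by fact
      show "j s * x \<in> S'" using ys j_nonzero by simp
      show "j (\<pi> ^ n) * x \<in> S'" using n x order(2)[OF S'] by blast
    qed
  qed
  then have inj: "inj_on (localised_order j \<pp>) (overorders_at j \<pp> R)"
    by (intro inj_onI) (metis subset_antisym)
  have surj: "\<exists>S\<in>overorders_at j \<pp> R. localised_order j \<pp> S = T"
    if T: "T \<in> overorders_over Dp (localised_order j \<pp> R)" for T
  proof -
    define L where "L = localised_order j \<pp> R"
    have L_eq: "L = {y / j s | y s. y \<in> R \<and> s \<notin> \<pp>}"
      unfolding L_def by (rule localised_order_iff(1)[OF R])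
    have T_order: "is_order_over Dp T" and LT: "L \<subseteq> T"
      using T by (auto simp: overorders_over_def L_def)
    note subT = loc.order_submod[OF T_order]
    have subL: "loc.submod L" unfolding L_def
      by (rule loc.order_submod[OF localised_order_is_order[OF R]])
    have RL: "R \<subseteq> L"
    proof
      fix x assume "x \<in> R"
      moreover have "x = x / j 1" by (simp add: j_one)
      ultimately show "x \<in> L" unfolding L_eq using p_one by blast
    qed
    have R_frac: "\<exists>d. d \<noteq> 0 \<and> j d * z \<in> R" for z
      using R j_zero unfolding is_order_iff by (metis imageE)
    obtain B where B: "finite B" "span_over Dp B = T" using T_order unfolding loc.is_order_iff by blast
    obtain d where d: "\<And>b. d b \<noteq> 0 \<and> j (d b) * b \<in> R" using R_frac by metis
    \<comment> \<open>\<open>d0\<close> carries every generator of \<open>T\<close> into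
      \<open>R\<close>. Its factor \<open>u\<close> is invertible in \<open>Dp\<close>, so the power
      of \<pi> alone carries \<open>T\<close> into \<open>L\<close>.\<close>
    define d0 where "d0 = (\<Prod>b\<in>B. d b)"
    have "d0 \<noteq> 0" using B(1) d by (simp add: d0_def)
    then obtain m u where mu: "d0 = \<pi> ^ m * u" "u \<notin> \<pp>" using prime_power_decomposition by blast
    have T_L: "j (\<pi> ^ m) * x \<in> L" if x: "x \<in> T" for x
    proof -
      have "j d0 * x \<in> (*) (j d0) ` span_over Dp B" using x B by blast
      also have "\<dots> = span_over Dp ((*) (j d0) ` B)" by (rule loc.span_image_mult[symmetric])
      also have "\<dots> \<subseteq> L"
      proof (rule loc.span_least[OF subL], rule image_subsetI)
        fix b assume b: "b \<in> B"
        have "j d0 * b = j (\<Prod>c\<in>B - {b}. d c) * (j (d b) * b)"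
          using prod.remove[OF B(1) b, of d] by (simp add: d0_def j_mult mult.commute mult.left_commute)
        also have "\<dots> \<in> R" by (rule submod_scale[OF subR rangeI conjunct2[OF d]])
        finally show "j d0 * b \<in> L" using RL by blast
      qed
      finally have "(j 1 / j u) * (j d0 * x) \<in> L"
        using localised_ringI[OF mu(2)] loc.submod_scale[OF subL] by blast
      also have "(j 1 / j u) * (j d0 * x) = j (\<pi> ^ m) * x"
        using j_nonzero[OF mu(2)] by (simp add: mu(1) j_one j_mult)
      finally show ?thesis .
    qed
    define S where "S = {x \<in> T. \<exists>n. j (\<pi> ^ n) * x \<in> R}"
    \<comment> \<open>The exponent \<open>n\<close> depends on \<open>x\<close>, but
      \<open>T_L\<close> offers a uniform \<open>m\<close> at the price of a denominator
      \<open>s\<close> outside \<pp>. The individual power of \<pi> allows \<open>cancel\<close> to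
      remove \<open>s\<close>.\<close>
    have S_R: "j (\<pi> ^ m) * x \<in> R" if x: "x \<in> S" for x
    proof -
      obtain n where n: "j (\<pi> ^ n) * x \<in> R" "x \<in> T" using x by (auto simp: S_def)
      obtain y s where ys: "j (\<pi> ^ m) * x = y / j s" "y \<in> R" "s \<notin> \<pp>"
        using T_L[OF n(2)] unfolding L_eq by blast
      show ?thesis
      proof (rule cancel[OF subR ys(3)])
        show "j s * (j (\<pi> ^ m) * x) \<in> R" using ys j_nonzero by simp
        have "j (\<pi> ^ n) * (j (\<pi> ^ m) * x) = j (\<pi> ^ m) * (j (\<pi> ^ n) * x)" by simp
        then show "j (\<pi> ^ n) * (j (\<pi> ^ m) * x) \<in> R"
          using submod_scale[OF subR rangeI n(1)] by metis
      qed
    qed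
    have S_iff: "x \<in> S \<longleftrightarrow> x \<in> T \<and> j (\<pi> ^ m) * x \<in> R" for x using S_R by (auto simp: S_def)
    have RS: "R \<subseteq> S" using RL LT submod_scale[OF subR rangeI] unfolding S_iff subset_iff by blast
    have R_mult: "x * y \<in> R" if "x \<in> R" "y \<in> R" for x y using R that unfolding is_order_iff by blast
    have T_mult: "x * y \<in> T" if "x \<in> T" "y \<in> T" for x y using T_order that unfolding loc.is_order_iff by blast
    have subS: "submod S" unfolding submod_def
    proof (intro conjI ballI)
      show "0 \<in> S" using RS submod_zero[OF subR] by blast
      show "x + y \<in> S" if "x \<in> S" "y \<in> S" for x y
        using that loc.submod_add[OF subT] submod_add[OF subR] by (auto simp: S_iff distrib_left)
      show "a * x \<in> S" if "a \<in> range j" "x \<in> S" for a x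
      proof -
        have "a * (j (\<pi> ^ m) * x) \<in> R" using that(2) by (intro submod_scale[OF subR that(1)]) (simp add: S_iff)
        moreover have "a * x \<in> T"
          using that range_subset_localised by (intro loc.submod_scale[OF subT]) (auto simp: S_iff)
        ultimately show ?thesis by (simp add: S_iff mult.left_commute)
      qed
    qed
    have "is_order_over (range j) S" unfolding is_order_iff
    proof (intro conjI ballI allI)
      show "range j \<subseteq> S" using RS R unfolding is_order_iff by blast
      show "x + y \<in> S" if "x \<in> S" "y \<in> S" for x y using submod_add[OF subS that] .
      show "x * y \<in> S" if "x \<in> S" "y \<in> S" for x y
      proof -
        \<comment> \<open>The product only obtains the exponent \<open>m + m\<close>. This suffices
          because \<open>S\<close> is defined with an arbitrary exponent.\<close>
        have "j (\<pi> ^ (m + m)) * (x * y) = (j (\<pi> ^ m) * x) * (j (\<pi> ^ m) * y)"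
          by (simp add: power_add j_mult mult.assoc mult.left_commute)
        also have "\<dots> \<in> R" using that by (auto simp: S_iff intro!: R_mult[of "j (\<pi> ^ m) * x" "j (\<pi> ^ m) * y"])
        finally show ?thesis using that T_mult by (auto simp: S_def)
      qed
      show "\<exists>d\<in>range j. d \<noteq> 0 \<and> d * z \<in> S" for z
        using R RS unfolding is_order_iff by blast
      let ?p = "j (\<pi> ^ m)"
      have p_nz: "?p \<noteq> 0" using \<pi>_nz by (simp add: j_eq_zero_iff)
      obtain C where C: "finite C" "indep C" "span_over (range j) C = R" using order_has_basis[OF R] .
      \<comment> \<open>Scaling by the power of \<pi> places \<open>S\<close> inside the free module
        \<open>R\<close>, where submodules are finitely generated; the generators are scaled
        back.\<close>
      have "(*) ?p ` S \<subseteq> R" by (auto simp: S_iff)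
      then obtain Y where "finite Y" "span_over (range j) Y = (*) ?p ` S"
        by (rule stacked_bases[OF C submod_image_mult[OF subS]])
      then have "finite ((*) (inverse ?p) ` Y)" "span_over (range j) ((*) (inverse ?p) ` Y) = S"
        using p_nz by (simp_all add: span_image_mult image_image flip: mult.assoc)
      then show "\<exists>B. finite B \<and> span_over (range j) B = S" by blast
    qed
    then have S: "S \<in> overorders_at j \<pp> R"
      using RS S_R by (intro annihilated_overorder[OF subR])
    moreover have "localised_order j \<pp> S = T"
      unfolding localised_order_iff(1)[OF order(1)[OF S]]
    proof
      show "{y / j s | y s. y \<in> S \<and> s \<notin> \<pp>} \<subseteq> T"
      proof safe
        fix y s assume "y \<in> S" "s \<notin> \<pp>"
        then have "(j 1 / j s) * y \<in> T"
          using localised_ringI by (intro loc.submod_scale[OF subT]) (auto simp: S_iff)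
        then show "y / j s \<in> T" by (simp add: j_one)
      qed
      show "T \<subseteq> {y / j s | y s. y \<in> S \<and> s \<notin> \<pp>}"
      proof
        fix x assume x: "x \<in> T"
        obtain y s where ys: "j (\<pi> ^ m) * x = y / j s" "y \<in> R" "s \<notin> \<pp>"
          using T_L[OF x] unfolding L_eq by blast
        \<comment> \<open>Multiplying \<open>x\<close> by the denominator \<open>s\<close> leaves
          only a power of \<pi> between it and \<open>R\<close>, so \<open>j s * x\<close> is in
          \<open>S\<close> and x is recovered as a fraction over \<open>s\<close>.\<close>
        have "j (\<pi> ^ m) * (j s * x) = y"
          using ys j_nonzero by (simp add: mult.left_commute)
        moreover have "j s * x \<in> T"
          using x range_subset_localised by (intro loc.submod_scale[OF subT]) auto
        ultimately have "j s * x \<in> S" using ys by (simp add: S_iff)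
        moreover have "x = (j s * x) / j s" using j_nonzero[OF ys(3)] by simp
        ultimately show "x \<in> {y / j s | y s. y \<in> S \<and> s \<notin> \<pp>}" using ys(3) by blast
      qed
    qed
    ultimately show ?thesis by blast
  qed
  show ?thesis
    unfolding bij_betw_def using inj image surj by (auto intro: rev_image_eqI)
qed

end

section \<open>The order \<open>A[x]/(f)\<close>\<close>

context euclidean_subdomain
begin

text \<open>The powers of \<open>y\<close> span a finitely generated module, so \<open>y\<close> is integral over \<open>D\<close>; the
  constant term of an integral equation of minimal degree is the required multiple of \<open>y\<close>.\<close>

lemma nonzero_multiple_in_base:
  assumes B: "finite B" "span_over D B = S" and mult: "\<And>x y. x \<in> S \<Longrightarrow> y \<in> S \<Longrightarrow> x * y \<in> S"
    and one: "1 \<in> S" and y: "y \<in> S" "y \<noteq> 0"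
  shows "\<exists>s\<in>S. y * s \<in> D \<and> y * s \<noteq> 0"
proof -
  define P where "P k = (\<lambda>i. y ^ i) ` {..<k}" for k :: nat
  define N where "N = (\<Union>k. span_over D (P k))"
  have subS: "submod S" using B(2) submod_span by blast
  have pow: "y ^ i \<in> S" for i by (induction i) (auto intro: one mult y)
  have mono: "span_over D (P k) \<subseteq> span_over D (P l)" if "k \<le> l" for k l
    using that by (intro span_mono) (auto simp: P_def)
  have subP: "span_over D (P k) \<subseteq> S" for k
    by (rule span_least[OF subS]) (auto simp: P_def pow)
  have subN: "submod N" unfolding submod_def
  proof (intro conjI ballI)
    show "0 \<in> N" using submod_zero[OF submod_span] by (auto simp: N_def)
  next
    fix u v assume "u \<in> N" "v \<in> N"
    then obtain k l where "u \<in> span_over D (P k)" "v \<in> span_over D (P l)" by (auto simp: N_def)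
    then have "u \<in> span_over D (P (max k l))" "v \<in> span_over D (P (max k l))"
      using mono[of k "max k l"] mono[of l "max k l"] by auto
    then show "u + v \<in> N" using submod_add[OF submod_span] by (auto simp: N_def)
  next
    fix a u assume "a \<in> D" "u \<in> N"
    then show "a * u \<in> N" using submod_scale[OF submod_span] by (auto simp: N_def)
  qed
  have "N \<subseteq> S" using subP by (auto simp: N_def)
  obtain C where C: "finite C" "span_over D C = S" "indep C"
    using finite_span_has_basis[OF B(1)] B(2) by (auto simp: is_basis_iff)
  obtain Y where Y: "finite Y" "span_over D Y = N"
    using \<open>N \<subseteq> S\<close> by (rule stacked_bases[OF C(1,3,2) subN])
  have "\<forall>x\<in>Y. \<exists>k. x \<in> span_over D (P k)" using span_superset[of Y] Y(2) by (auto simp: N_def)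
  then obtain K where K: "\<And>x. x \<in> Y \<Longrightarrow> x \<in> span_over D (P (K x))" by metis
  \<comment> \<open>The sum serves as a common upper bound for all \<open>K x\<close>.\<close>
  define l where "l = (\<Sum>x\<in>Y. K x)"
  have "Y \<subseteq> span_over D (P l)"
  proof
    fix x assume x: "x \<in> Y"
    then have "K x \<le> l" unfolding l_def by (intro member_le_sum) (auto simp: Y)
    with K[OF x] mono show "x \<in> span_over D (P l)" by blast
  qed
  then have NP: "N \<subseteq> span_over D (P l)" unfolding Y(2)[symmetric] by (intro span_least submod_span)
  \<comment> \<open>The span of the first \<open>l\<close> powers already exhausts \<open>N\<close>,
    so \<open>y ^ l\<close> depends on lower powers with coefficients in D.\<close>
  have "y ^ l \<in> span_over D (P (Suc l))" using span_superset[of "P (Suc l)"] by (auto simp: P_def)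
  then have "\<exists>k. y ^ k \<in> span_over D (P k)" using NP by (auto simp: N_def)
  define k where "k = (LEAST k. y ^ k \<in> span_over D (P k))"
  have k: "y ^ k \<in> span_over D (P k)" unfolding k_def by (rule LeastI_ex) fact
  have min: "y ^ i \<notin> span_over D (P i)" if "i < k" for i
    using that not_less_Least unfolding k_def by blast
  have "k \<noteq> 0"
  proof
    assume "k = 0"
    with k show False by (simp add: P_def span_finite)
  qed
  then obtain m where m: "k = Suc m" by (cases k) auto
  \<comment> \<open>Separating the power with exponent 0 isolates the constant term
    \<open>a\<close>; everything else is divisible by \<open>y\<close>.\<close>
  have "P (Suc m) = insert 1 ((*) y ` P m)"
    unfolding P_def lessThan_Suc_eq_insert_0 by (simp add: image_image)
  then have "span_over D (P k) = {a * 1 + w | a w. a \<in> D \<and> w \<in> (*) y ` span_over D (P m)}"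
    by (simp only: m span_insert span_image_mult)
  with k obtain a w where aw: "a \<in> D" "w \<in> span_over D (P m)" "y ^ k = a + y * w" by auto
  then have eq: "y * (y ^ m - w) = a" by (simp add: m right_diff_distrib)
  \<comment> \<open>If the constant term vanished, cancelling \<open>y\<close> would give an
    integral equation of smaller degree.\<close>
  have "a \<noteq> 0"
  proof
    assume "a = 0"
    with eq y have "y ^ m = w" by simp
    with aw(2) min[of m] m show False by simp
  qed
  moreover have "y ^ m - w \<in> S" using pow subP aw(2) by (intro submod_diff[OF subS]) auto
  ultimately show ?thesis using eq aw(1) by (intro bexI[of _ "y ^ m - w"]) auto
qed

end

context euclidean_embedding
begin

text \<open>Division by the monic \<open>f\<close> makes the monomials below its degree generators.
  For the spanning condition, \<open>nonzero_multiple_in_base\<close> multiplies a denominator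
  \<open>ev h\<close> into the copy of A.\<close>

lemma is_order_over_adjoin_root:
  fixes ev :: "'a poly \<Rightarrow> 'k"
  assumes ev_add: "\<And>g h. ev (g + h) = ev g + ev h" and ev_mult: "\<And>g h. ev (g * h) = ev g * ev h"
    and ev_const: "\<And>a. ev [:a:] = j a"
    and f: "Polynomial.lead_coeff f = 1" "ev f = 0"
    and frac: "\<And>z. \<exists>g h. ev h \<noteq> 0 \<and> z = ev g / ev h"
  shows "is_order_over (range j) (range ev)"
proof -
  define B where "B = (\<lambda>i. ev (Polynomial.monom 1 i)) ` {..<Polynomial.degree f}"
  have ev_0: "ev 0 = 0" and ev_1: "ev 1 = 1"
    using ev_const[of 0] ev_const[of 1] by (simp_all add: j_zero j_one flip: one_pCons)
  have ev_sum: "ev (\<Sum>i\<in>I. g i) = (\<Sum>i\<in>I. ev (g i))" for g and I :: "nat set"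
    by (induction I rule: infinite_finite_induct) (simp_all add: ev_0 ev_add)
  have ev_monom: "ev (Polynomial.monom c i) = j c * ev (Polynomial.monom 1 i)" for c i
    using ev_mult[of "[:c:]" "Polynomial.monom 1 i"] by (simp add: smult_monom ev_const)
  have mult: "x * y \<in> range ev" if "x \<in> range ev" "y \<in> range ev" for x y
    using that by (auto simp flip: ev_mult)
  have add: "x + y \<in> range ev" if "x \<in> range ev" "y \<in> range ev" for x y
    using that by (auto simp flip: ev_add)
  have range: "range j \<subseteq> range ev" by (auto simp flip: ev_const)
  have "submod (range ev)" unfolding submod_def using add mult range ev_0 by (metis rangeI subsetD)
  then have "span_over (range j) B \<subseteq> range ev" by (rule span_least) (auto simp: B_def)
  moreover have "range ev \<subseteq> span_over (range j) B"
  proof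
    fix x assume "x \<in> range ev"
    then obtain g where x: "x = ev g" by blast
    \<comment> \<open>The coefficients form a ring, hence pseudo-division; its multiplier is a power
      of the leading coefficient, here 1, so this is division with remainder.\<close>
    obtain q r where qr: "pseudo_divmod g f = (q, r)" by (cases "pseudo_divmod g f")
    have "f \<noteq> 0" using f(1) by auto
    note pd = pseudo_divmod[OF this qr]
    then have "g = f * q + r" using f(1) by simp
    then have x_r: "x = ev r" using f(2) by (simp add: x ev_add ev_mult)
    show "x \<in> span_over (range j) B"
    proof (cases "r = 0")
      case True
      then show ?thesis using submod_zero[OF submod_span] by (simp add: x_r ev_0)
    next
      case False
      then have deg: "Polynomial.degree r < Polynomial.degree f" using pd by simp
      have "x = (\<Sum>i\<le>Polynomial.degree r. ev (Polynomial.monom (Polynomial.coeff r i) i))"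
        unfolding x_r by (simp add: poly_as_sum_of_monoms flip: ev_sum)
      also have "\<dots> = (\<Sum>i\<le>Polynomial.degree r. j (Polynomial.coeff r i) * ev (Polynomial.monom 1 i))"
        by (intro sum.cong refl ev_monom)
      also have "\<dots> \<in> span_over (range j) B"
      proof (rule submod_sum[OF submod_span], rule submod_scale[OF submod_span rangeI])
        fix i assume "i \<in> {..Polynomial.degree r}"
        then have "ev (Polynomial.monom 1 i) \<in> B" using deg by (auto simp: B_def)
        then show "ev (Polynomial.monom 1 i) \<in> span_over (range j) B" using span_superset by blast
      qed
      finally show ?thesis .
    qed
  qed
  ultimately have span: "span_over (range j) B = range ev" by blast
  have "finite B" by (simp add: B_def)
  have one: "1 \<in> range ev" using ev_1 by (metis rangeI)
  show ?thesis unfolding is_order_iff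
  proof (intro conjI ballI allI)
    fix z
    obtain g h where gh: "ev h \<noteq> 0" "z = ev g / ev h" using frac by blast
    obtain s where s: "s \<in> range ev" "ev h * s \<in> range j" "ev h * s \<noteq> 0"
      using nonzero_multiple_in_base[OF \<open>finite B\<close> span mult one rangeI gh(1)] by blast
    have "(ev h * s) * z = ev g * s" using gh by simp
    also have "\<dots> \<in> range ev" using s(1) by (intro mult) auto
    finally show "\<exists>d\<in>range j. d \<noteq> 0 \<and> d * z \<in> range ev" using s by blast
  qed (use mult add range span \<open>finite B\<close> in auto)
qed

end

theorem proposition4p10:
  fixes \<pp> :: "'q::{finite, field} poly set"
    and f :: "'q poly poly"
    and \<iota> :: "'q poly poly set \<Rightarrow> 'k::field"
  defines "j \<equiv> base_map f \<iota>"
  defines "R \<equiv> \<iota> ` carrier (poly_quotient f)"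
  assumes "primeideal \<pp> (ring_of_type_algebra :: 'q poly ring)" and "\<pp> \<noteq> {0}"
    and "Polynomial.lead_coeff f = 1" and "Factorial_Ring.irreducible f"
    and "is_fraction_field (poly_quotient f) \<iota>"
  shows "bij_betw (localised_order j \<pp>)
    (overorders_at j \<pp> R)
    (overorders_over (localised_ring j \<pp>) (localised_order j \<pp> R))"
proof -
  let ?I = "cgenideal (ring_of_type_algebra :: 'q poly poly ring) f"
  \<comment> \<open>The composite of reduction modulo \<open>f\<close> with \<iota> lets elements of
    the quotient ring be handled as polynomials; its kernel is generated by
    \<open>f\<close>.\<close>
  define ev where "ev g = \<iota> (?I +>\<^bsub>ring_of_type_algebra\<^esub> g)" for g
  have I_eq: "?I = multiples f" by (rule cgenideal_type_algebra)
  interpret I: ideal ?I "ring_of_type_algebra :: 'q poly poly ring"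
    unfolding I_eq by (rule ideal_multiples)
  interpret Q: quotient_setup "regular_module (ring_of_type_algebra :: 'q poly poly ring)" ?I
    by (rule quotient_setup_regular) (rule I.is_ideal)
  have coset: "?I +>\<^bsub>ring_of_type_algebra\<^esub> g = coset ?I g" for g
    by (auto simp: a_r_coset_def' coset_def)
  have \<iota>: "\<iota> \<in> ring_hom (poly_quotient f) ring_of_type_algebra" "inj_on \<iota> (carrier (poly_quotient f))"
    "\<And>z. \<exists>a\<in>carrier (poly_quotient f). \<exists>b\<in>carrier (poly_quotient f).
       b \<noteq> \<zero>\<^bsub>poly_quotient f\<^esub> \<and> z = \<iota> a / \<iota> b"
    using assms(7) unfolding is_fraction_field_def by auto
  have carrier: "carrier (poly_quotient f) = range (\<lambda>g. ?I +>\<^bsub>ring_of_type_algebra\<^esub> g)"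
    by (auto simp: poly_quotient_def FactRing_def A_RCOSETS_def')
  have rcos: "(\<lambda>g. ?I +>\<^bsub>ring_of_type_algebra\<^esub> g) \<in> ring_hom ring_of_type_algebra (poly_quotient f)"
    unfolding poly_quotient_def by (rule I.rcos_ring_hom)
  have "ev \<in> ring_hom ring_of_type_algebra ring_of_type_algebra"
    using ring_hom_trans[OF rcos \<iota>(1)] by (simp add: ev_def[abs_def] comp_def)
  note ev_hom = this
  have ev_add: "ev (g + h) = ev g + ev h" and ev_mult: "ev (g * h) = ev g * ev h"
    and ev_1: "ev 1 = 1" for g h
    using ring_hom_add[OF ev_hom, of g h] ring_hom_mult[OF ev_hom, of g h] ring_hom_one[OF ev_hom]
    by simp_all
  have ev_eq_iff: "ev g = ev h \<longleftrightarrow> f dvd g - h" for g h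
  proof -
    have "ev g = ev h \<longleftrightarrow> coset ?I g = coset ?I h"
      unfolding ev_def using inj_on_eq_iff[OF \<iota>(2)] carrier coset by (metis rangeI)
    then show ?thesis unfolding Q.coset_eq_iff by (simp add: I_eq)
  qed
  have ev_0: "ev 0 = 0" using ev_add[of 0 0] by (metis add_0 add_cancel_left_left)
  have j_eq: "j a = ev [:a:]" for a by (simp add: j_def base_map_def ev_def)
  \<comment> \<open>A monic constant would be the unit 1. Positive degree prevents \<open>f\<close>
    from dividing a nonzero constant, which makes \<open>j\<close> injective.\<close>
  have deg: "Polynomial.degree f \<noteq> 0"
  proof
    assume "Polynomial.degree f = 0"
    then have "f = [:1:]" using assms(5) by (metis degree_0_id)
    then have "is_unit f" by (simp add: one_pCons)
    with assms(6) show False by (simp add: Factorial_Ring.irreducible_def)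
  qed
  interpret euclidean_embedding j
  proof
    show "j \<in> ring_hom ring_of_type_algebra ring_of_type_algebra"
      by (rule ring_hom_memI) (simp_all add: j_eq ev_1 mult.commute flip: ev_add ev_mult one_pCons)
    show "inj j"
    proof (rule injI)
      fix a b assume "j a = j b"
      then have "f dvd [:a - b:]" by (simp add: j_eq ev_eq_iff)
      with deg have "[:a - b:] = 0" by (metis degree_pCons_0 dvd_imp_degree_le le_zero_eq)
      then show "a = b" by simp
    qed
  qed
  interpret p: primeideal \<pp> "ring_of_type_algebra :: 'q poly ring" by (rule assms(3))
  note p_ideal = ideal_type_algebraD[OF p.is_ideal]
  obtain \<pi> where \<pi>: "\<pp> = multiples \<pi>"
    using euclidean_principal[OF p_ideal(1,2,4)] by blast
  interpret localisation j \<pp> \<pi>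
  proof
    show "\<pi> \<noteq> 0" using \<pi> assms(4) by auto
  qed (fact assms(3) \<pi>)+
  have R_eq: "R = range ev" by (auto simp: R_def carrier ev_def)
  have "is_order_over (range j) R" unfolding R_eq
  proof (rule is_order_over_adjoin_root[OF ev_add ev_mult j_eq[symmetric] assms(5)])
    show "ev f = 0" using ev_eq_iff[of f 0] ev_0 by simp
    show "\<exists>g h. ev h \<noteq> 0 \<and> z = ev g / ev h" for z
    proof -
      obtain g h where gh: "?I +>\<^bsub>ring_of_type_algebra\<^esub> h \<noteq> \<zero>\<^bsub>poly_quotient f\<^esub>" "z = ev g / ev h"
        using \<iota>(3)[of z] unfolding carrier by (auto simp: ev_def)
      have "ev h \<noteq> 0"
      proof
        assume "ev h = 0"
        then have "h \<in> ?I" using ev_eq_iff[of h 0] ev_0 by (simp add: I_eq)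
        then have "coset ?I h = ?I" by (simp only: Q.coset_eq_N_iff)
        with gh(1) show False by (simp add: coset poly_quotient_def FactRing_def)
      qed
      with gh show ?thesis by blast
    qed
  qed
  then show ?thesis by (rule bij_betw_localised_order)
qed

end
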